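(* Suppose that the Regularity assumption, the Parameter assumption and the Localization assumption of the context hold, and run NR-LALM (with exact gradients) from $(x_0,\lambda_0)$. Define $$\mathcal E(x,\lambda,w):=\mathcal L_\rho(x,\lambda)+\frac{\beta}{4}\|w\|^2,\qquad u_k:=(x_k,\lambda_k,p_{k-1})\quad(k\ge1).$$ Assume also that $\mathcal S_{\mathrm{det}}$ is compact and that $\mathcal E$ has the Kurdyka--Łojasiewicz (KL) property at every point of the cluster set $\Omega:=\{\bar u:\text{there is a subsequence }u_{k_j}\to\bar u\}$. Then the primal--dual trajectory has finite length, $$\sum_{k=0}^\infty\left(\|x_{k+1}-x_k\|+\|\lambda_{k+1}-\lambda_k\|\right)<\infty,$$ and the entire sequence $(x_k,\lambda_k)$ converges to a KKT pair $(x_\star,\lambda_\star)$ of the problem $\min f(x)$ subject to $c(x)=0$. Moreover, $u_k\to(x_\star,\lambda_\star,0)$.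
   Context: Here $f:\mathbb R^n\to\mathbb R$, $c:\mathbb R^n\to\mathbb R^m$. Norms are Euclidean for vectors and spectral for matrices; $\nabla c(x):=(\nabla c_1(x),\ldots,\nabla c_m(x))\in\mathbb R^{n\times m}$. The augmented Lagrangian is $\mathcal L_\rho(x,\lambda):=f(x)+\langle\lambda,c(x)\rangle+\frac{\rho}{2}\|c(x)\|^2$. A KKT pair is $(x,\lambda)$ with $\nabla f(x)+\nabla c(x)\lambda=0$ and $c(x)=0$. Regularity assumption: $f$ and $c$ are continuously differentiable on a nonempty open set $\mathcal U\subseteq\mathbb R^n$, and there are $\underline f\in\mathbb R$ and positive constants $G,L_f,M,L_c,\sigma$ such that for all $x,y\in\mathcal U$ and $u\in\mathbb R^m$: (i) $f(x)\ge\underline f$, $\|\nabla f(x)\|\le G$, $\|\nabla f(x)-\nabla f(y)\|\le L_f\|x-y\|$; (ii) $\|\nabla c(x)\|\le M$, $\|\nabla c(x)-\nabla c(y)\|\le L_c\|x-y\|$; (iii) $\|\nabla c(x)u\|\ge\sigma\|u\|$. Constants: $\kappa_{\mathrm{lin}}:=L_c/2$ and, for $\beta,\rho,\Delta,\Lambda>0$, $$C_{\mathrm{mod}}:=\frac{L_f}{2}+\kappa_{\mathrm{lin}}(3\Lambda+\rho M\Delta)+\frac{\rho}{2}\kappa_{\mathrm{lin}}^2\Delta^2,\quad A_p:=\beta+\rho M\kappa_{\mathrm{lin}}\Delta,\quad B_p:=A_p+L_f+L_c\Lambda,\quad C_{\lambda,p}:=\frac{4}{\sigma^2}\max\{A_p^2,B_p^2\}.$$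 Parameter assumption: the fixed constants $\beta,\rho,\Delta,\Lambda>0$ satisfy $$\Lambda\ge\frac{G+\beta\Delta+\rho M\kappa_{\mathrm{lin}}\Delta^2}{\sigma},\quad \frac{G}{\beta}+\frac{3M\Lambda}{\beta+\rho\sigma^2}\le\Delta,\quad C_{\mathrm{mod}}\le\frac{3\beta}{8},\quad \rho\ge\frac{8C_{\lambda,p}}{\beta},$$ and the initial pair satisfies $\|\lambda_0\|\le\Lambda$ and $\rho\|c(x_0)\|\le\Lambda$. NR-LALM (deterministic): from $(x_0,\lambda_0)\in\mathbb R^n\times\mathbb R^m$, for $k=0,1,2,\ldots$, $p_k$ is the solution of $$(\beta I_n+\rho\nabla c(x_k)\nabla c(x_k)^\top)p_k=-\nabla f(x_k)-\nabla c(x_k)(\lambda_k+\rho c(x_k)),$$ and $x_{k+1}=x_k+p_k$, $\lambda_{k+1}=\lambda_k+\rho c(x_{k+1})$. Localization: let $$\overline\Phi_1:=f(x_0)+G\Delta+\frac{4\Lambda^2}{\rho}+\frac{C_{\lambda,p}}{\rho}\Delta^2,\quad H_{\mathrm{det}}:=\overline\Phi_1+\frac{\Lambda^2}{2\rho},\quad \mathcal S_{\mathrm{det}}:=\{x\in\mathbb R^n:f(x)\le H_{\mathrm{det}},\ \|c(x)\|\le2\Lambda/\rho\},$$ and $\mathcal N_r(S):=\{y\in\mathbb R^n:\operatorname{dist}(y,S)\le r\}$. Localization assumption: $\mathcal N_\Delta(\mathcal S_{\mathrm{det}})\subset\mathcal U$. KL property: let $\mathcal D\subseteq\mathbb R^q$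 be open. A continuously differentiable $h:\mathcal D\to\mathbb R$ has the KL property at $\bar z\in\mathcal D$ if there exist a neighborhood $\mathcal V\subseteq\mathcal D$ of $\bar z$, $\eta>0$, and a continuous concave function $\varphi:[0,\eta)\to[0,\infty)$ with $\varphi(0)=0$, $\varphi\in C^1((0,\eta))$, $\varphi'(s)>0$ for $s\in(0,\eta)$, such that $\varphi'(h(z)-h(\bar z))\|\nabla h(z)\|\ge1$ whenever $z\in\mathcal V$ and $0<h(z)-h(\bar z)<\eta$. Here it is applied to $\mathcal E$ on the open set $\mathcal U\times\mathbb R^m\times\mathbb R^n$. *)

theory Defs
  imports "HOL-Analysis.Analysis"
begin

section \<open>Gradients and norms\<close>

definition grad :: "('a::real_inner \<Rightarrow> real) \<Rightarrow> 'a \<Rightarrow> 'a"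
  where "grad f x = (THE g. GDERIV f x :> g)"

lemma grad_eqI:
  assumes "GDERIV f x :> g"
  shows "grad f x = g"
  unfolding grad_def
proof (rule the_equality)
  show "GDERIV f x :> g" by fact
next
  fix g' assume "GDERIV f x :> g'"
  with assms have "(\<lambda>h. h \<bullet> g') = (\<lambda>h. h \<bullet> g)"
    unfolding gderiv_def by (intro has_derivative_unique)
  then have "(g' - g) \<bullet> g' = (g' - g) \<bullet> g"
    by (rule fun_cong)
  then have "(g' - g) \<bullet> (g' - g) = 0"
    by (simp add: inner_diff_right)
  then show "g' = g"
    by simp
qed

(* Columns are the component gradients: an n x m matrix, the transpose of the Jacobian matrix. *)
definition grad_mat :: "(real^'n \<Rightarrow> real^'m) \<Rightarrow> real^'n \<Rightarrow> real^'m^'n"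
  where "grad_mat c x = (\<chi> i j. grad (\<lambda>y. c y $ j) x $ i)"

(* The library norm on real^'m^'n is the Frobenius norm, hence the operator norm here. *)
definition spectral_norm :: "real^'m^'n \<Rightarrow> real"
  where "spectral_norm A = onorm (\<lambda>v. A *v v)"

definition C1_on :: "('a::real_normed_vector \<Rightarrow> 'b::real_normed_vector) \<Rightarrow> 'a set \<Rightarrow> bool"
  where "C1_on f U \<longleftrightarrow>
    (\<exists>f' :: 'a \<Rightarrow> 'a \<Rightarrow>\<^sub>L 'b.
      (\<forall>x\<in>U. (f has_derivative blinfun_apply (f' x)) (at x)) \<and> continuous_on U f')"

section \<open>The constrained problem\<close>

definition aug_Lagrangian ::
  "(real^'n \<Rightarrow> real) \<Rightarrow> (real^'n \<Rightarrow> real^'m) \<Rightarrow> real \<Rightarrow> real^'n \<Rightarrow> real^'m \<Rightarrow> real"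
  where "aug_Lagrangian f c \<rho> x lam = f x + lam \<bullet> c x + \<rho> / 2 * (norm (c x))\<^sup>2"

(* Differentiability at x makes the two gradients meaningful. *)
definition KKT_pair ::
  "(real^'n \<Rightarrow> real) \<Rightarrow> (real^'n \<Rightarrow> real^'m) \<Rightarrow> real^'n \<Rightarrow> real^'m \<Rightarrow> bool"
  where "KKT_pair f c x lam \<longleftrightarrow>
    f differentiable (at x) \<and> c differentiable (at x) \<and>
    grad f x + grad_mat c x *v lam = 0 \<and> c x = 0"

definition regularity_assumption ::
  "(real^'n \<Rightarrow> real) \<Rightarrow> (real^'n \<Rightarrow> real^'m) \<Rightarrow> (real^'n) set \<Rightarrow>
    real \<Rightarrow> real \<Rightarrow> real \<Rightarrow> real \<Rightarrow> real \<Rightarrow> real \<Rightarrow> bool"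
  where "regularity_assumption f c U f_low G L_f M L_c \<sigma> \<longleftrightarrow>
    open U \<and> U \<noteq> {} \<and> C1_on f U \<and> C1_on c U \<and>
    G > 0 \<and> L_f > 0 \<and> M > 0 \<and> L_c > 0 \<and> \<sigma> > 0 \<and>
    (\<forall>x\<in>U. f x \<ge> f_low \<and> norm (grad f x) \<le> G) \<and>
    (\<forall>x\<in>U. \<forall>y\<in>U. norm (grad f x - grad f y) \<le> L_f * norm (x - y)) \<and>
    (\<forall>x\<in>U. spectral_norm (grad_mat c x) \<le> M) \<and>
    (\<forall>x\<in>U. \<forall>y\<in>U. spectral_norm (grad_mat c x - grad_mat c y) \<le> L_c * norm (x - y)) \<and>
    (\<forall>x\<in>U. \<forall>u. norm (grad_mat c x *v u) \<ge> \<sigma> * norm u)"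

section \<open>Constants and parameters\<close>

definition kappa_lin :: "real \<Rightarrow> real"
  where "kappa_lin L_c = L_c / 2"

definition C_mod :: "real \<Rightarrow> real \<Rightarrow> real \<Rightarrow> real \<Rightarrow> real \<Rightarrow> real \<Rightarrow> real"
  where "C_mod \<rho> \<Delta> \<Lambda> L_f M L_c =
    L_f / 2 + kappa_lin L_c * (3 * \<Lambda> + \<rho> * M * \<Delta>) + \<rho> / 2 * (kappa_lin L_c)\<^sup>2 * \<Delta>\<^sup>2"

definition A_p :: "real \<Rightarrow> real \<Rightarrow> real \<Rightarrow> real \<Rightarrow> real \<Rightarrow> real"
  where "A_p \<beta> \<rho> \<Delta> M L_c = \<beta> + \<rho> * M * kappa_lin L_c * \<Delta>"

definition B_p :: "real \<Rightarrow> real \<Rightarrow> real \<Rightarrow> real \<Rightarrow> real \<Rightarrow> real \<Rightarrow> real \<Rightarrow> real"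
  where "B_p \<beta> \<rho> \<Delta> \<Lambda> L_f M L_c = A_p \<beta> \<rho> \<Delta> M L_c + L_f + L_c * \<Lambda>"

definition C_lam_p :: "real \<Rightarrow> real \<Rightarrow> real \<Rightarrow> real \<Rightarrow> real \<Rightarrow> real \<Rightarrow> real \<Rightarrow> real \<Rightarrow> real"
  where "C_lam_p \<beta> \<rho> \<Delta> \<Lambda> L_f M L_c \<sigma> =
    4 / \<sigma>\<^sup>2 * max ((A_p \<beta> \<rho> \<Delta> M L_c)\<^sup>2) ((B_p \<beta> \<rho> \<Delta> \<Lambda> L_f M L_c)\<^sup>2)"

definition parameter_assumption ::
  "(real^'n \<Rightarrow> real^'m) \<Rightarrow> real^'n \<Rightarrow> real^'m \<Rightarrow> real \<Rightarrow> real \<Rightarrow> real \<Rightarrow> real \<Rightarrow>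
    real \<Rightarrow> real \<Rightarrow> real \<Rightarrow> real \<Rightarrow> real \<Rightarrow> bool"
  where "parameter_assumption c x0 lam0 \<beta> \<rho> \<Delta> \<Lambda> G L_f M L_c \<sigma> \<longleftrightarrow>
    \<beta> > 0 \<and> \<rho> > 0 \<and> \<Delta> > 0 \<and> \<Lambda> > 0 \<and>
    \<Lambda> \<ge> (G + \<beta> * \<Delta> + \<rho> * M * kappa_lin L_c * \<Delta>\<^sup>2) / \<sigma> \<and>
    G / \<beta> + 3 * M * \<Lambda> / (\<beta> + \<rho> * \<sigma>\<^sup>2) \<le> \<Delta> \<and>
    C_mod \<rho> \<Delta> \<Lambda> L_f M L_c \<le> 3 * \<beta> / 8 \<and>
    \<rho> \<ge> 8 * C_lam_p \<beta> \<rho> \<Delta> \<Lambda> L_f M L_c \<sigma> / \<beta> \<and>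
    norm lam0 \<le> \<Lambda> \<and> \<rho> * norm (c x0) \<le> \<Lambda>"

section \<open>The algorithm\<close>

(* For \<beta>, \<rho> > 0 the system matrix is positive definite, so the linear equation
   determines p k uniquely and the relation describes exactly one run from (x 0, lam 0). *)
definition NR_LALM ::
  "(real^'n \<Rightarrow> real) \<Rightarrow> (real^'n \<Rightarrow> real^'m) \<Rightarrow> real \<Rightarrow> real \<Rightarrow>
    (nat \<Rightarrow> real^'n) \<Rightarrow> (nat \<Rightarrow> real^'m) \<Rightarrow> (nat \<Rightarrow> real^'n) \<Rightarrow> bool"
  where "NR_LALM f c \<beta> \<rho> x lam p \<longleftrightarrow>
    (\<forall>k. (\<beta> *\<^sub>R mat 1 + \<rho> *\<^sub>R (grad_mat c (x k) ** transpose (grad_mat c (x k)))) *v p k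
            = - grad f (x k) - grad_mat c (x k) *v (lam k + \<rho> *\<^sub>R c (x k)) \<and>
         x (Suc k) = x k + p k \<and>
         lam (Suc k) = lam k + \<rho> *\<^sub>R c (x (Suc k)))"

section \<open>Localization\<close>

definition Phi_1 ::
  "(real^'n \<Rightarrow> real) \<Rightarrow> real^'n \<Rightarrow> real \<Rightarrow> real \<Rightarrow> real \<Rightarrow> real \<Rightarrow>
    real \<Rightarrow> real \<Rightarrow> real \<Rightarrow> real \<Rightarrow> real \<Rightarrow> real"
  where "Phi_1 f x0 \<beta> \<rho> \<Delta> \<Lambda> G L_f M L_c \<sigma> =
    f x0 + G * \<Delta> + 4 * \<Lambda>\<^sup>2 / \<rho> + C_lam_p \<beta> \<rho> \<Delta> \<Lambda> L_f M L_c \<sigma> / \<rho> * \<Delta>\<^sup>2"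

definition H_det ::
  "(real^'n \<Rightarrow> real) \<Rightarrow> real^'n \<Rightarrow> real \<Rightarrow> real \<Rightarrow> real \<Rightarrow> real \<Rightarrow>
    real \<Rightarrow> real \<Rightarrow> real \<Rightarrow> real \<Rightarrow> real \<Rightarrow> real"
  where "H_det f x0 \<beta> \<rho> \<Delta> \<Lambda> G L_f M L_c \<sigma> =
    Phi_1 f x0 \<beta> \<rho> \<Delta> \<Lambda> G L_f M L_c \<sigma> + \<Lambda>\<^sup>2 / (2 * \<rho>)"

definition S_det ::
  "(real^'n \<Rightarrow> real) \<Rightarrow> (real^'n \<Rightarrow> real^'m) \<Rightarrow> real^'n \<Rightarrow> real \<Rightarrow> real \<Rightarrow> real \<Rightarrow> real \<Rightarrow>
    real \<Rightarrow> real \<Rightarrow> real \<Rightarrow> real \<Rightarrow> real \<Rightarrow> (real^'n) set"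
  where "S_det f c x0 \<beta> \<rho> \<Delta> \<Lambda> G L_f M L_c \<sigma> =
    {x. f x \<le> H_det f x0 \<beta> \<rho> \<Delta> \<Lambda> G L_f M L_c \<sigma> \<and> norm (c x) \<le> 2 * \<Lambda> / \<rho>}"

(* infdist y {} = 0 in the library; the guard restores dist(y, {}) = infinity. *)
definition nbhd :: "real \<Rightarrow> 'a::metric_space set \<Rightarrow> 'a set"
  where "nbhd r S = {y. S \<noteq> {} \<and> infdist y S \<le> r}"

section \<open>Kurdyka-Lojasiewicz property\<close>

definition desingularizing :: "real \<Rightarrow> (real \<Rightarrow> real) \<Rightarrow> bool"
  where "desingularizing \<eta> \<phi> \<longleftrightarrow>
    continuous_on {0..<\<eta>} \<phi> \<and> concave_on {0..<\<eta>} \<phi> \<and> (\<forall>s\<in>{0..<\<eta>}. \<phi> s \<ge> 0) \<and> \<phi> 0 = 0 \<and>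
    \<phi> C1_differentiable_on {0<..<\<eta>} \<and> (\<forall>s\<in>{0<..<\<eta>}. deriv \<phi> s > 0)"

(* Meant for an open D on which h is continuously differentiable. *)
definition KL_property :: "'a::euclidean_space set \<Rightarrow> ('a \<Rightarrow> real) \<Rightarrow> 'a \<Rightarrow> bool"
  where "KL_property D h zb \<longleftrightarrow>
    (\<exists>V \<eta> \<phi>. zb \<in> interior V \<and> V \<subseteq> D \<and> \<eta> > 0 \<and> desingularizing \<eta> \<phi> \<and>
      (\<forall>z\<in>V. 0 < h z - h zb \<and> h z - h zb < \<eta> \<longrightarrow>
        deriv \<phi> (h z - h zb) * norm (grad h z) \<ge> 1))"

definition merit ::
  "(real^'n \<Rightarrow> real) \<Rightarrow> (real^'n \<Rightarrow> real^'m) \<Rightarrow> real \<Rightarrow> real \<Rightarrow>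
    (real^'n) \<times> (real^'m) \<times> (real^'n) \<Rightarrow> real"
  where "merit f c \<beta> \<rho> = (\<lambda>(x, lam, w). aug_Lagrangian f c \<rho> x lam + \<beta> / 4 * (norm w)\<^sup>2)"

(* Only meaningful for k \<ge> 1; at k = 0 natural-number subtraction gives the spurious entry p 0. *)
definition lifted_iterate :: "(nat \<Rightarrow> 'a) \<Rightarrow> (nat \<Rightarrow> 'b) \<Rightarrow> (nat \<Rightarrow> 'a) \<Rightarrow> nat \<Rightarrow> 'a \<times> 'b \<times> 'a"
  where "lifted_iterate x lam p k = (x k, lam k, p (k - 1))"

(* Subsequential limits of (u k) for k \<ge> 1. *)
definition cluster_set :: "(nat \<Rightarrow> 'a::topological_space) \<Rightarrow> 'a set"
  where "cluster_set u =
    {ub. \<exists>r. strict_mono r \<and> (\<forall>j. r j \<ge> (1::nat)) \<and> (\<lambda>j. u (r j)) \<longlonglongrightarrow> ub}"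

end

(* Testing the regularized Newton system with its own solution gives a decrease of the augmented
   Lagrangian of order |p_k|^2 in the primal step. The dual step raises it by
   |lam_{k+1} - lam_k|^2 / rho, which the full-rank condition on the Jacobian, applied to two
   consecutive approximate stationarity equations, bounds by C_lam_p / (2 rho) (|p_k|^2 + |p_{k-1}|^2).
   Hence L_rho + (C_lam_p / rho) |p_{k-1}|^2 never exceeds Phi_1, which keeps the iterates in S_det,
   and the merit function decreases by a multiple of |p_k|^2 while its gradient at u_k is bounded by
   a multiple of |p_k| + |p_{k-1}| + |p_{k-2}|. The KL inequality then turns the decrease into
   summability of |p_k|. *)
theory Submission
  imports Defs
begin

text \<open>Every bound on \<open>f\<close> and \<open>c\<close> is available on \<open>U\<close>
  only, while membership of the next iterate in \<open>U\<close> is itself a consequence of descent.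
  The circle is broken because \<open>good k\<close> alone bounds |p_k| by \<Delta>, which puts the
  whole segment to x_{k+1} inside \<open>U\<close>, and bounds lam_{k+1} by \<Lambda>; the latter
  bound comes from stationarity, since adding up dual increments would not give a uniform one.
  Comparing two stationarity equations controls dual increments from the second one on, so the first
  step is bounded crudely, which accounts for the shape of \<open>Phi_1\<close>. The gap between
  \<open>Phi_1\<close> and \<open>H_det\<close> is the price of passing from the augmented
  Lagrangian back to \<open>f\<close>. On the KL side, a finite cover of a compact set containing
  the iterates takes the place of a uniform KL inequality near the cluster set.\<close>

section \<open>Matrices and linearization\<close>

(* Otherwise transpose A *v u is rewritten to u v* A, away from the form in which it is stated below. *)
declare transpose_matrix_vector [simp del]

lemma inner_matrix_vector:
  fixes A :: "real^'m^'n"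
  shows "(A *v u) \<bullet> v = u \<bullet> (transpose A *v v)"
  by (metis dot_lmul_matrix inner_commute transpose_matrix_vector)

lemma norm_matrix_vector_le:
  assumes "spectral_norm A \<le> M"
  shows "norm (A *v u) \<le> M * norm u"
proof -
  have "norm (A *v u) \<le> spectral_norm A * norm u"
    unfolding spectral_norm_def by (rule onorm) simp
  also have "\<dots> \<le> M * norm u"
    using assms by (intro mult_right_mono) auto
  finally show ?thesis .
qed

text \<open>\<open>spectral_norm\<close> is the operator norm of \<open>A\<close> itself. Testing
  \<open>A\<close> with w = \<open>transpose A *v u\<close> gives |w|^2 = <A w, u>, and cancelling
  |w| carries the bound over to the transpose.\<close>

lemma norm_transpose_vector_le:
  fixes A :: "real^'m^'n"
  assumes "spectral_norm A \<le> M"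
  shows "norm (transpose A *v u) \<le> M * norm u"
proof -
  let ?w = "transpose A *v u"
  have "norm ?w * norm ?w = (A *v ?w) \<bullet> u"
    by (simp add: inner_matrix_vector flip: power2_eq_square dot_square_norm)
  also have "\<dots> \<le> norm (A *v ?w) * norm u"
    by (rule norm_cauchy_schwarz)
  also have "\<dots> \<le> (M * norm ?w) * norm u"
    by (intro mult_right_mono norm_matrix_vector_le assms norm_ge_zero)
  finally have *: "norm ?w * norm ?w \<le> norm ?w * (M * norm u)"
    by (simp add: mult_ac)
  have "0 \<le> M"
    using assms onorm_pos_le[of "(*v) A"] unfolding spectral_norm_def by simp
  show ?thesis
  proof (cases "norm ?w = 0")
    case True
    then show ?thesis using \<open>0 \<le> M\<close> by simp
  next
    case False
    then show ?thesis using * by (simp add: mult_le_cancel_left)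
  qed
qed

lemma norm_triangle_diff3: "norm (a - b - c - d) \<le> norm a + norm b + norm c + norm d"
  for a b c d :: "'a::real_normed_vector"
  using norm_triangle_ineq4[of "a - b - c" d] norm_triangle_ineq4[of "a - b" c] norm_triangle_ineq4[of a b]
  by linarith

lemma transpose_diff_vector: "transpose (A - B) *v u = transpose A *v u - transpose B *v u"
  for A B :: "real^'m^'n"
proof -
  have "transpose (A - B) = transpose A - transpose B"
    by (simp add: transpose_def vec_eq_iff)
  then show ?thesis
    by (simp add: matrix_vector_mult_diff_rdistrib)
qed

text \<open>Makes the definite description in \<open>grad\<close> usable: in a Euclidean space the
  derivative \<open>D\<close> is represented by the vector \<open>adjoint D 1\<close>.\<close>

lemma GDERIV_grad:
  fixes f :: "'a::euclidean_space \<Rightarrow> real"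
  assumes "f differentiable (at x)"
  shows "GDERIV f x :> grad f x"
proof -
  obtain D where D: "(f has_derivative D) (at x)"
    using assms unfolding differentiable_def by blast
  have "D = (\<lambda>h. h \<bullet> adjoint D 1)"
    using adjoint_works[OF has_derivative_linear[OF D], of _ 1] by auto
  then have "GDERIV f x :> adjoint D 1"
    using D by (simp add: gderiv_def)
  then show ?thesis
    using grad_eqI by metis
qed

lemma has_derivative_grad_mat:
  fixes c :: "real^'n \<Rightarrow> real^'m"
  assumes "c differentiable (at x)"
  shows "(c has_derivative (\<lambda>h. transpose (grad_mat c x) *v h)) (at x)"
proof -
  obtain D where D: "(c has_derivative D) (at x)"
    using assms unfolding differentiable_def by blast
  have "D h = transpose (grad_mat c x) *v h" for h
  proof (rule vec_eq_iff[THEN iffD2], rule allI)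
    fix j
    have Dj: "((\<lambda>y. c y $ j) has_derivative (\<lambda>h. D h $ j)) (at x)"
      using bounded_linear.has_derivative[OF bounded_linear_vec_nth D] .
    then have "GDERIV (\<lambda>y. c y $ j) x :> grad (\<lambda>y. c y $ j) x"
      by (intro GDERIV_grad) (auto simp: differentiable_def)
    with Dj have "(\<lambda>h. D h $ j) = (\<lambda>h. h \<bullet> grad (\<lambda>y. c y $ j) x)"
      unfolding gderiv_def by (rule has_derivative_unique)
    then have "D h $ j = h \<bullet> grad (\<lambda>y. c y $ j) x"
      by meson
    then show "D h $ j = (transpose (grad_mat c x) *v h) $ j"
      by (simp add: matrix_vector_mult_def transpose_def grad_mat_def inner_vec_def mult.commute)
  qed
  then have "D = (\<lambda>h. transpose (grad_mat c x) *v h)"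
    by (rule ext)
  then show ?thesis
    using D by simp
qed

lemma C1_on_differentiable:
  assumes "C1_on f U" "x \<in> U"
  shows "f differentiable (at x)"
  using assms unfolding C1_on_def differentiable_def by blast

text \<open>Along the segment, F minus its linear part has a derivative of norm at most L t |p|^2,
  which integrates to L / 2 |p|^2. Both hypotheses concern the segment and the direction
  \<open>p\<close> alone, as \<open>U\<close> need not be convex.\<close>

lemma linearization_error:
  fixes F :: "'a::real_normed_vector \<Rightarrow> 'b::real_normed_vector"
  assumes der: "\<And>t. t \<in> {0..1} \<Longrightarrow> (F has_derivative D (x + t *\<^sub>R p)) (at (x + t *\<^sub>R p))"
    and lip: "\<And>t. t \<in> {0..1} \<Longrightarrow> norm (D (x + t *\<^sub>R p) p - D x p) \<le> L * t * (norm p)\<^sup>2"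
  shows "norm (F (x + p) - F x - D x p) \<le> L / 2 * (norm p)\<^sup>2"
proof -
  let ?F = "\<lambda>t. F (x + t *\<^sub>R p) - t *\<^sub>R D x p"
  let ?\<phi> = "\<lambda>t::real. L / 2 * (norm p)\<^sup>2 * t\<^sup>2"
  have d1: "(?F has_vector_derivative (D (x + t *\<^sub>R p) p - D x p)) (at t)" if "t \<in> {0..1}" for t
  proof -
    have lin: "D (x + t *\<^sub>R p) (a *\<^sub>R p) = a *\<^sub>R D (x + t *\<^sub>R p) p" for a
      using has_derivative_linear[OF der[OF that]] by (rule linear_cmul)
    have "((F \<circ> (\<lambda>t. x + t *\<^sub>R p)) has_derivative (D (x + t *\<^sub>R p) \<circ> (\<lambda>h. h *\<^sub>R p))) (at t)"
      by (rule diff_chain_at) (auto intro!: derivative_eq_intros der that)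
    then have "((\<lambda>t. F (x + t *\<^sub>R p)) has_vector_derivative D (x + t *\<^sub>R p) p) (at t)"
      by (simp add: o_def has_vector_derivative_def lin)
    then show ?thesis
      by (auto intro!: derivative_eq_intros)
  qed
  have d2: "(?\<phi> has_vector_derivative (L * t * (norm p)\<^sup>2)) (at t)" for t
    by (auto intro!: derivative_eq_intros simp: field_simps simp flip: has_real_derivative_iff_has_vector_derivative)
  have "norm (?F 1 - ?F 0) \<le> ?\<phi> 1 - ?\<phi> 0"
  proof (rule differentiable_bound_general[where f' = "\<lambda>t. D (x + t *\<^sub>R p) p - D x p" and \<phi>' = "\<lambda>t. L * t * (norm p)\<^sup>2"])
    show "continuous_on {0..1} ?F"
      by (intro continuous_at_imp_continuous_on ballI has_vector_derivative_continuous[OF d1])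
    show "continuous_on {0..1} ?\<phi>"
      by (intro continuous_intros)
  qed (use d1 d2 lip in auto)
  then show ?thesis
    by (simp add: algebra_simps)
qed

text \<open>Coercivity of the system matrix alone would give the factor 1 / \<beta> for both terms.
  For the term J v, the identity (\<beta> I + \<rho> J J^T)^-1 J = J (\<beta> I + \<rho> J^T J)^-1
  moves the inverse to the multiplier space, where \<sigma> makes the matrix at least \<beta> +
  \<rho> \<sigma>^2.\<close>

lemma tikhonov_step_bound:
  fixes J :: "real^'m^'n"
  assumes pos: "\<beta> > 0" "\<rho> > 0" and M: "spectral_norm J \<le> M" and sig: "\<And>u. \<sigma> * norm u \<le> norm (J *v u)"
    and "\<sigma> > 0"
    and eq: "\<beta> *\<^sub>R p + \<rho> *\<^sub>R (J *v (transpose J *v p)) = - g - J *v v"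
  shows "norm p \<le> norm g / \<beta> + M * norm v / (\<beta> + \<rho> * \<sigma>\<^sup>2)"
proof -
  have M0: "0 \<le> M"
    using M onorm_pos_le[of "(*v) J"] unfolding spectral_norm_def by simp
  define T where "T = (\<lambda>w. \<beta> *\<^sub>R w + \<rho> *\<^sub>R (transpose J *v (J *v w)))"
  have linT: "linear T"
    unfolding T_def
    by (intro linearI) (simp_all add: matrix_vector_right_distrib matrix_vector_mult_scaleR algebra_simps)
  have Tw: "(\<beta> + \<rho> * \<sigma>\<^sup>2) * norm w \<le> norm (T w)" for w
  proof (cases "w = 0")
    case False
    have "(\<beta> + \<rho> * \<sigma>\<^sup>2) * (norm w * norm w) = \<beta> * (norm w)\<^sup>2 + \<rho> * (\<sigma> * norm w)\<^sup>2"
      by (simp add: power2_eq_square algebra_simps)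
    also have "\<dots> \<le> \<beta> * (norm w)\<^sup>2 + \<rho> * (norm (J *v w))\<^sup>2"
      using pos sig \<open>\<sigma> > 0\<close> by (intro add_left_mono mult_left_mono power_mono) auto
    also have "\<dots> = w \<bullet> T w"
      by (simp add: T_def inner_add_right power2_norm_eq_inner inner_matrix_vector)
    also have "\<dots> \<le> norm w * norm (T w)"
      by (rule norm_cauchy_schwarz)
    finally have "norm w * ((\<beta> + \<rho> * \<sigma>\<^sup>2) * norm w) \<le> norm w * norm (T w)"
      by (simp add: mult_ac)
    then show ?thesis
      using False by (simp add: mult_le_cancel_left)
  qed (simp add: T_def)
  have den: "\<beta> + \<rho> * \<sigma>\<^sup>2 > 0"
    using pos by (simp add: add_pos_nonneg)
  have "inj T"
  proof (rule linear_injective_0[OF linT, THEN iffD2], intro allI impI)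
    fix w assume "T w = 0"
    then have "(\<beta> + \<rho> * \<sigma>\<^sup>2) * norm w \<le> 0" using Tw[of w] by simp
    then show "w = 0" using den by (simp add: mult_le_0_iff)
  qed
  then obtain w where w: "T w = v"
    using linear_injective_imp_surjective[OF linT] by (metis surjD)
  have nw: "norm w \<le> norm v / (\<beta> + \<rho> * \<sigma>\<^sup>2)"
    using Tw[of w] den by (simp add: w field_simps)
  \<comment> \<open>With T w = v, adding J w removes the J v term, so \<open>q\<close> solves the
    system with right-hand side - g, for which coercivity in \<beta> is enough.\<close>
  define q where "q = p + J *v w"
  have "\<beta> *\<^sub>R q + \<rho> *\<^sub>R (J *v (transpose J *v q))
      = (\<beta> *\<^sub>R p + \<rho> *\<^sub>R (J *v (transpose J *v p))) + J *v T w"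
    by (simp add: q_def T_def matrix_vector_right_distrib matrix_vector_mult_scaleR algebra_simps)
  also have "\<dots> = - g"
    by (simp add: eq w)
  finally have q: "\<beta> *\<^sub>R q + \<rho> *\<^sub>R (J *v (transpose J *v q)) = - g" .
  have "\<beta> * (norm q * norm q) \<le> \<beta> * (norm q)\<^sup>2 + \<rho> * (norm (transpose J *v q))\<^sup>2"
    using pos by (simp add: power2_eq_square)
  also have "\<dots> = (\<beta> *\<^sub>R q + \<rho> *\<^sub>R (J *v (transpose J *v q))) \<bullet> q"
    by (simp add: inner_add_left power2_norm_eq_inner inner_matrix_vector)
  also have "\<dots> \<le> norm g * norm q"
    unfolding q using norm_cauchy_schwarz[of "- g" q] by simp
  finally have "norm q * (\<beta> * norm q) \<le> norm q * norm g"
    by (simp add: mult_ac)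
  then have nq: "norm q \<le> norm g / \<beta>"
    using pos by (cases "q = 0") (auto simp: field_simps)
  have "norm p \<le> norm q + norm (J *v w)"
    using norm_triangle_ineq4[of q "J *v w"] by (simp add: q_def)
  also have "norm (J *v w) \<le> M * norm w"
    by (rule norm_matrix_vector_le[OF M])
  also have "\<dots> \<le> M * (norm v / (\<beta> + \<rho> * \<sigma>\<^sup>2))"
    using nw M0 by (rule mult_left_mono)
  finally show ?thesis
    using nq by simp
qed

section \<open>Finite length from the KL property\<close>

text \<open>By the arithmetic-geometric mean inequality, the root of the product is at most 3/2 of
  the decrease of \<psi> plus 1/6 of the three-term sum. Three shares of 1/6 are absorbed by the
  left side, of which one half survives.\<close>

lemma summable_three_term_recursion:
  fixes a \<psi> :: "nat \<Rightarrow> real"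
  assumes a: "\<And>k. 0 \<le> a k" and \<psi>: "\<And>k. 0 \<le> \<psi> k" "\<And>k. \<psi> (Suc k) \<le> \<psi> k"
    and rec: "\<And>k. (a (k + 2))\<^sup>2 \<le> (\<psi> k - \<psi> (Suc k)) * (a (k + 2) + a (k + 1) + a k)"
  shows "summable a"
proof -
  have step: "a (k + 2) \<le> 3 / 2 * (\<psi> k - \<psi> (Suc k)) + (a (k + 2) + a (k + 1) + a k) / 6" for k
  proof (rule power2_le_imp_le)
    define d s where "d = \<psi> k - \<psi> (Suc k)" and "s = a (k + 2) + a (k + 1) + a k"
    have "d * s \<le> (3 / 2 * d + s / 6)\<^sup>2"
      using zero_le_power2[of "3 / 2 * d - s / 6"] by (simp add: power2_eq_square field_simps)
    then show "(a (k + 2))\<^sup>2 \<le> (3 / 2 * (\<psi> k - \<psi> (Suc k)) + (a (k + 2) + a (k + 1) + a k) / 6)\<^sup>2"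
      using rec[of k] unfolding d_def s_def by linarith
    show "0 \<le> 3 / 2 * (\<psi> k - \<psi> (Suc k)) + (a (k + 2) + a (k + 1) + a k) / 6"
      using a \<psi>(2)[of k] by simp
  qed
  \<comment> \<open>The weights 2/6 and 1/6 count occurrences still to come: from step n on,
    \<open>a (n + 1)\<close> enters the right side as an older term in steps n and n + 1,
    \<open>a n\<close> only in step n.\<close>
  have potential: "3 / 2 * \<psi> n + (2 * a (n + 1) + a n) / 6 + (\<Sum>k<n. a (k + 2)) / 2
      \<le> 3 / 2 * \<psi> 0 + (2 * a 1 + a 0) / 6" for n
  proof (induction n)
    case (Suc n)
    then show ?case using step[of n] by (simp add: field_simps)
  qed simp
  have "(\<Sum>k<n. a (k + 2)) \<le> 3 * \<psi> 0 + (2 * a 1 + a 0) / 3" for n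
    using potential[of n] \<psi>(1)[of n] a[of n] a[of "n + 1"] by (simp add: field_simps)
  then have "summable (\<lambda>k. a (k + 2))"
    by (intro summableI_nonneg_bounded a)
  then show ?thesis
    by (rule summable_iff_shift[THEN iffD1])
qed

text \<open>A concave function lies below its tangent. The tangent is taken at the interior point
  \<open>s\<close>, while \<open>t\<close> may be 0, where the slope of \<phi> can be
  infinite.\<close>

lemma desingularizing_tangent:
  assumes \<phi>: "desingularizing \<eta> \<phi>" and s: "0 < s" "s < \<eta>" and t: "0 \<le> t" "t < \<eta>"
  shows "deriv \<phi> s * (s - t) \<le> \<phi> s - \<phi> t"
proof -
  have "\<phi> C1_differentiable_on {0<..<\<eta>}" and conv: "convex_on {0..<\<eta>} (\<lambda>s. - \<phi> s)"
    using \<phi> by (auto simp: desingularizing_def concave_on_def)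
  then have "(\<phi> has_field_derivative deriv \<phi> s) (at s)"
    using s by (auto simp: C1_differentiable_on_eq DERIV_deriv_iff_real_differentiable)
  then have "((\<lambda>s. - \<phi> s) has_field_derivative - deriv \<phi> s) (at s within {0..<\<eta>})"
    by (auto intro!: derivative_eq_intros intro: has_field_derivative_at_within)
  then have "- \<phi> t - - \<phi> s \<ge> - deriv \<phi> s * (t - s)"
    using s t by (intro convex_on_imp_above_tangent[OF conv]) (auto simp: interior_atLeastLessThan)
  then show ?thesis
    by (simp add: algebra_simps)
qed

lemma desingularizing_mono:
  assumes \<phi>: "desingularizing \<eta> \<phi>" and "0 \<le> t" "t \<le> s" "s < \<eta>"
  shows "\<phi> t \<le> \<phi> s"
proof (cases "s = 0")
  case False
  then have "0 < deriv \<phi> s"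
    using assms by (auto simp: desingularizing_def)
  then have "0 \<le> deriv \<phi> s * (s - t)"
    using assms by simp
  also have "\<dots> \<le> \<phi> s - \<phi> t"
    using assms False by (intro desingularizing_tangent[OF \<phi>]) auto
  finally show ?thesis by simp
qed (use assms in auto)

text \<open>Infinitely many visits to every ball would allow a choice of increasing indices along
  which the sequence tends to \<open>z\<close>. The lemma serves to discard those members of a cover
  that are centred away from the cluster set.\<close>

lemma non_cluster_point_nbhd:
  fixes u :: "nat \<Rightarrow> 'a::metric_space"
  assumes "z \<notin> cluster_set u"
  obtains O' where "open O'" "z \<in> O'" "finite {k. u k \<in> O'}"
proof -
  have "\<exists>e>0. finite {k. u k \<in> ball z e}"
  proof (rule ccontr)
    assume "\<not> ?thesis"
    then have inf: "infinite {k. u k \<in> ball z e}" if "e > 0" for e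
      using that by blast
    have ex: "\<exists>k>N. u k \<in> ball z (1 / Suc n)" for n N
      using inf[of "1 / Suc n"] unfolding infinite_nat_iff_unbounded by auto
    have "\<exists>r. \<forall>n. (r n \<ge> 1 \<and> u (r n) \<in> ball z (1 / Suc n)) \<and> r n < r (Suc n)"
    proof (rule dependent_nat_choice)
      show "\<exists>k. k \<ge> 1 \<and> u k \<in> ball z (1 / Suc 0)"
        using ex[of 0 0] by (metis One_nat_def Suc_leI)
      show "\<exists>k'. (k' \<ge> 1 \<and> u k' \<in> ball z (1 / Suc (Suc n))) \<and> k < k'" if "k \<ge> 1 \<and> u k \<in> ball z (1 / Suc n)" for k n
        using ex[of k "Suc n"] that by (meson le_trans less_imp_le)
    qed
    then obtain r where r: "\<And>n. r n \<ge> 1" "\<And>n. u (r n) \<in> ball z (1 / Suc n)" "\<And>n. r n < r (Suc n)"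
      by blast
    have "(\<lambda>n. dist (u (r n)) z) \<longlonglongrightarrow> 0"
    proof (rule tendsto_sandwich[OF _ _ tendsto_const LIMSEQ_Suc[OF lim_1_over_n]])
      show "\<forall>\<^sub>F n in sequentially. dist (u (r n)) z \<le> 1 / real (Suc n)"
        using r(2) by (intro always_eventually) (auto simp: dist_commute less_imp_le simp del: of_nat_Suc)
    qed auto
    then have "(\<lambda>n. u (r n)) \<longlonglongrightarrow> z"
      by (rule tendsto_dist_iff[THEN iffD2])
    then have "z \<in> cluster_set u"
      using r unfolding cluster_set_def by (auto simp: strict_mono_Suc_iff)
    with assms show False ..
  qed
  then show ?thesis
    using that by (metis centre_in_ball open_ball)
qed

text \<open>Decrease, KL slope and gradient bound combine into the three-term recursion.
  \<open>K\<close> is covered by KL neighbourhoods of cluster points and by neighbourhoods of other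
  points, visited finitely often; from some index on, only the former are met.\<close>

lemma KL_finite_length:
  fixes u :: "nat \<Rightarrow> 'a::euclidean_space" and h :: "'a \<Rightarrow> real"
  assumes K: "compact K" "\<And>k. k \<ge> 1 \<Longrightarrow> u k \<in> K"
    and KL: "\<And>z. z \<in> cluster_set u \<Longrightarrow> KL_property D h z"
    and cont: "\<And>z. z \<in> cluster_set u \<Longrightarrow> isCont h z"
    and "\<alpha> > 0" "b > 0" and a: "\<And>k. 0 \<le> a k"
    and decrease: "\<And>k. k \<ge> 1 \<Longrightarrow> \<alpha> * (a k)\<^sup>2 \<le> h (u k) - h (u (Suc k))"
    and gradient: "\<And>k. norm (grad h (u (k + 2))) \<le> b * (a (k + 2) + a (k + 1) + a k)"
  shows "summable a"
proof -
  let ?\<Omega> = "cluster_set u"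
  have mono: "h (u k) \<le> h (u j)" if "1 \<le> j" "j \<le> k" for j k
    using that(2)
  proof (induction k rule: dec_induct)
    case (step n)
    have "0 \<le> \<alpha> * (a n)\<^sup>2" using \<open>\<alpha> > 0\<close> by simp
    then show ?case using decrease[of n] step that(1) by linarith
  qed simp
  obtain l where hl: "(\<lambda>k. h (u k)) \<longlonglongrightarrow> l"
  proof -
    \<comment> \<open>The shift keeps indices at least 1, where the iterates lie in
      \<open>K\<close>. The value of \<open>h\<close> at a cluster point supplies the lower bound of
      \<open>h\<close> along the sequence.\<close>
    obtain ub r where r: "strict_mono r" "((\<lambda>k. u (Suc k)) \<circ> r) \<longlonglongrightarrow> ub"
      using K unfolding compact_def by (metis le_add1 plus_1_eq_Suc)
    then have "strict_mono (\<lambda>j. Suc (r j))" "(\<lambda>j. u (Suc (r j))) \<longlonglongrightarrow> ub"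
      by (auto simp: strict_mono_def o_def)
    then have "ub \<in> ?\<Omega>"
      unfolding cluster_set_def by auto
    then have lim: "(\<lambda>j. h (u (Suc (r j)))) \<longlonglongrightarrow> h ub"
      using r(2) by (intro isCont_tendsto_compose[OF cont]) (auto simp: o_def)
    have "h ub \<le> h (u (Suc k))" for k
    proof (rule LIMSEQ_le_const2[OF lim], intro exI allI impI)
      fix j assume "k \<le> j"
      then show "h (u (Suc (r j))) \<le> h (u (Suc k))"
        using seq_suble[OF r(1), of j] by (intro mono) auto
    qed
    moreover have "decseq (\<lambda>k. h (u (Suc k)))"
      by (rule decseq_SucI) (simp add: mono)
    ultimately obtain l where "(\<lambda>k. h (u (Suc k))) \<longlonglongrightarrow> l"
      using decseq_convergent by metis
    then show ?thesis
      by (rule that[OF LIMSEQ_imp_Suc])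
  qed
  have h_ge: "l \<le> h (u k)" if "k \<ge> 1" for k
    using that by (intro LIMSEQ_le_const2[OF hl] exI[of _ k]) (auto intro: mono)
  have h_cluster: "h z = l" if z: "z \<in> ?\<Omega>" for z
  proof -
    obtain r where r: "strict_mono r" "(\<lambda>j. u (r j)) \<longlonglongrightarrow> z"
      using z unfolding cluster_set_def by auto
    have "(\<lambda>j. h (u (r j))) \<longlonglongrightarrow> h z"
      by (rule isCont_tendsto_compose[OF cont[OF z] r(2)])
    moreover have "(\<lambda>j. h (u (r j))) \<longlonglongrightarrow> l"
      using LIMSEQ_subseq_LIMSEQ[OF hl r(1)] by (simp add: o_def)
    ultimately show ?thesis
      by (rule LIMSEQ_unique)
  qed
  have "\<forall>z\<in>?\<Omega>. \<exists>V \<eta> \<phi>. z \<in> interior V \<and> \<eta> > 0 \<and> desingularizing \<eta> \<phi> \<and>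
      (\<forall>y\<in>V. 0 < h y - l \<and> h y - l < \<eta> \<longrightarrow> deriv \<phi> (h y - l) * norm (grad h y) \<ge> 1)"
    using KL h_cluster unfolding KL_property_def by metis
  then obtain V \<eta> \<phi> where V: "\<And>z. z \<in> ?\<Omega> \<Longrightarrow> z \<in> interior (V z)"
    and \<eta>: "\<And>z. z \<in> ?\<Omega> \<Longrightarrow> \<eta> z > 0"
    and \<phi>: "\<And>z. z \<in> ?\<Omega> \<Longrightarrow> desingularizing (\<eta> z) (\<phi> z)"
    and slope: "\<And>z y. z \<in> ?\<Omega> \<Longrightarrow> y \<in> V z \<Longrightarrow> 0 < h y - l \<Longrightarrow> h y - l < \<eta> z \<Longrightarrow>
        deriv (\<phi> z) (h y - l) * norm (grad h y) \<ge> 1"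
    by metis
  have "\<exists>O'. open O' \<and> z \<in> O' \<and> (z \<in> ?\<Omega> \<longrightarrow> O' \<subseteq> V z) \<and> (z \<notin> ?\<Omega> \<longrightarrow> finite {k. u k \<in> O'})" for z
  proof (cases "z \<in> ?\<Omega>")
    case True
    then show ?thesis
      using V[OF True] interior_subset by (intro exI[of _ "interior (V z)"]) auto
  next
    case False
    then show ?thesis
      using non_cluster_point_nbhd[of z u] by metis
  qed
  then obtain W where W: "\<And>z. open (W z)" "\<And>z. z \<in> W z"
    and WV: "\<And>z. z \<in> ?\<Omega> \<Longrightarrow> W z \<subseteq> V z" and W_fin: "\<And>z. z \<notin> ?\<Omega> \<Longrightarrow> finite {k. u k \<in> W z}"
    by metis
  obtain T where T: "finite T" "K \<subseteq> (\<Union>z\<in>T. W z)"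
    by (rule compactE_image[OF K(1), of K W]) (use W in auto)
  define I where "I = T \<inter> ?\<Omega>"
  have I: "finite I" "I \<subseteq> ?\<Omega>"
    using T(1) by (auto simp: I_def)
  have ev1: "\<forall>\<^sub>F k in sequentially. \<forall>z\<in>T - ?\<Omega>. u k \<notin> W z"
    using T(1) W_fin
    by (intro eventually_ball_finite ballI) (simp_all add: eventually_cofinite flip: cofinite_eq_sequentially)
  have ev2: "\<forall>\<^sub>F k in sequentially. \<forall>z\<in>I. h (u k) < l + \<eta> z"
    using I \<eta> by (intro eventually_ball_finite ballI order_tendstoD(2)[OF hl]) auto
  from eventually_conj[OF ev1 ev2] obtain N where
    N: "\<And>k. k \<ge> N \<Longrightarrow> (\<forall>z\<in>T - ?\<Omega>. u k \<notin> W z) \<and> (\<forall>z\<in>I. h (u k) < l + \<eta> z)"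
    unfolding eventually_sequentially by blast
  have near: "\<exists>z\<in>I. u k \<in> V z" if k: "k \<ge> N" "k \<ge> 1" for k
  proof -
    obtain z where z: "z \<in> T" "u k \<in> W z"
      using K(2)[OF k(2)] T(2) by blast
    then have "z \<in> I"
      using N[OF k(1)] by (auto simp: I_def)
    then show ?thesis
      using z(2) I(2) WV by blast
  qed
  have small: "h (u k) - l < \<eta> z" if "k \<ge> N" "z \<in> I" for k z
    using N[OF that(1)] that(2) by force
  \<comment> \<open>Summing the finitely many desingularizing functions avoids building a uniform one: each
    summand is increasing, so the decrease of the sum dominates that of any single summand.\<close>
  define \<psi> where "\<psi> k = (\<Sum>z\<in>I. \<phi> z (h (u k) - l))" for k
  have dec: "\<phi> z (h (u (Suc k)) - l) \<le> \<phi> z (h (u k) - l)" if "k \<ge> N" "k \<ge> 1" "z \<in> I" for k z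
    using that I small[of k z] h_ge[of "Suc k"] mono[of k "Suc k"]
    by (intro desingularizing_mono[OF \<phi>]) auto
  have \<psi>_dec: "\<psi> (Suc k) \<le> \<psi> k" if "k \<ge> N" "k \<ge> 1" for k
    unfolding \<psi>_def by (intro sum_mono dec that)
  have \<psi>_nonneg: "0 \<le> \<psi> k" if "k \<ge> N" "k \<ge> 1" for k
    unfolding \<psi>_def
  proof (rule sum_nonneg)
    fix z assume "z \<in> I"
    then show "0 \<le> \<phi> z (h (u k) - l)"
      using \<phi>[of z] I small[OF that(1), of z] h_ge[OF that(2)] by (auto simp: desingularizing_def)
  qed
  have key: "h (u k) - h (u (Suc k)) \<le> norm (grad h (u k)) * (\<psi> k - \<psi> (Suc k))"
    if k: "k \<ge> N" "k \<ge> 1" for k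
  proof (cases "h (u k) = l")
    \<comment> \<open>The KL inequality is void at the limit level, but there the left side is at
      most 0 because \<open>h (u (Suc k))\<close> is at least \<open>l\<close>.\<close>
    case True
    then show ?thesis
      using h_ge[of "Suc k"] mult_nonneg_nonneg[OF norm_ge_zero[of "grad h (u k)"], of "\<psi> k - \<psi> (Suc k)"]
        \<psi>_dec[OF k] by linarith
  next
    case False
    obtain z where z: "z \<in> I" "u k \<in> V z"
      using near[OF k] by blast
    define s t where "s = h (u k) - l" and "t = h (u (Suc k)) - l"
    have st: "0 < s" "s < \<eta> z" "0 \<le> t" "t \<le> s"
      using False h_ge[OF k(2)] h_ge[of "Suc k"] mono[of k "Suc k"] small[OF k(1) z(1)] k(2)
      by (auto simp: s_def t_def)
    have zO: "z \<in> ?\<Omega>"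
      using z I by auto
    have "\<phi> z s - \<phi> z t \<le> (\<Sum>z\<in>I. \<phi> z s - \<phi> z t)"
      by (rule member_le_sum) (use z I dec[OF k] in \<open>auto simp: s_def t_def\<close>)
    then have le: "\<phi> z s - \<phi> z t \<le> \<psi> k - \<psi> (Suc k)"
      by (simp add: \<psi>_def s_def t_def sum_subtractf)
    have "s - t \<le> (deriv (\<phi> z) s * norm (grad h (u k))) * (s - t)"
      using mult_right_mono[OF slope[OF zO z(2)], of "s - t"] st by (simp add: s_def)
    also have "\<dots> = norm (grad h (u k)) * (deriv (\<phi> z) s * (s - t))"
      by simp
    also have "\<dots> \<le> norm (grad h (u k)) * (\<phi> z s - \<phi> z t)"
      using st by (intro mult_left_mono desingularizing_tangent[OF \<phi>[OF zO]]) auto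
    also have "\<dots> \<le> norm (grad h (u k)) * (\<psi> k - \<psi> (Suc k))"
      using le by (intro mult_left_mono) auto
    finally show ?thesis
      by (simp add: s_def t_def)
  qed
  have "summable (\<lambda>k. a (k + N))"
  \<comment> \<open>The offset 2 aligns \<psi> with the leading term \<open>a (k + 2)\<close> of the
    recursion; the factor b / \<alpha> collects the constants of the gradient bound and of the
    decrease.\<close>
  proof (rule summable_three_term_recursion[where \<psi> = "\<lambda>k. b / \<alpha> * \<psi> (k + N + 2)"])
    fix k
    let ?k = "k + N + 2" and ?S = "a (k + N + 2) + a (k + N + 1) + a (k + N)"
    have "\<alpha> * (a ?k)\<^sup>2 \<le> norm (grad h (u ?k)) * (\<psi> ?k - \<psi> (Suc ?k))"
      using decrease[of ?k] key[of ?k] by linarith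
    also have "\<dots> \<le> (b * ?S) * (\<psi> ?k - \<psi> (Suc ?k))"
      using gradient[of "k + N"] \<psi>_dec[of ?k] by (intro mult_right_mono) auto
    finally show "(a (k + 2 + N))\<^sup>2 \<le> (b / \<alpha> * \<psi> (k + N + 2) - b / \<alpha> * \<psi> (Suc k + N + 2)) *
        (a (k + 2 + N) + a (k + 1 + N) + a (k + N))"
      using \<open>\<alpha> > 0\<close> by (simp add: field_simps add_ac)
  next
    fix k
    show "0 \<le> b / \<alpha> * \<psi> (k + N + 2)" "b / \<alpha> * \<psi> (Suc k + N + 2) \<le> b / \<alpha> * \<psi> (k + N + 2)"
      using \<psi>_nonneg[of "k + N + 2"] \<psi>_dec[of "k + N + 2"] \<open>\<alpha> > 0\<close> \<open>b > 0\<close>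
      by (auto intro!: divide_right_mono mult_left_mono)
  qed (rule a)
  then show ?thesis
    by (rule summable_iff_shift[THEN iffD1])
qed

lemma convergent_if_finite_length:
  fixes X :: "nat \<Rightarrow> 'a::banach"
  assumes "summable (\<lambda>k. norm (X (Suc k) - X k))"
  obtains l where "X \<longlonglongrightarrow> l"
proof -
  have "(\<lambda>n. \<Sum>k<n. X (Suc k) - X k) \<longlonglongrightarrow> (\<Sum>k. X (Suc k) - X k)"
    by (intro summable_LIMSEQ summable_norm_cancel[OF assms])
  then have "(\<lambda>n. X n - X 0) \<longlonglongrightarrow> (\<Sum>k. X (Suc k) - X k)"
    by (simp add: sum_lessThan_telescope)
  from tendsto_add[OF this tendsto_const[of "X 0"]] show ?thesis
    using that by simp
qed

section \<open>The iteration\<close>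

locale NR_LALM_run =
  fixes f :: "real^'n \<Rightarrow> real" and c :: "real^'n \<Rightarrow> real^'m" and U :: "(real^'n) set"
    and f_low G L_f M L_c \<sigma> \<beta> \<rho> \<Delta> \<Lambda> :: real
    and x :: "nat \<Rightarrow> real^'n" and lam :: "nat \<Rightarrow> real^'m" and p :: "nat \<Rightarrow> real^'n"
  assumes regularity: "regularity_assumption f c U f_low G L_f M L_c \<sigma>"
    and parameters: "parameter_assumption c (x 0) (lam 0) \<beta> \<rho> \<Delta> \<Lambda> G L_f M L_c \<sigma>"
    and localization: "nbhd \<Delta> (S_det f c (x 0) \<beta> \<rho> \<Delta> \<Lambda> G L_f M L_c \<sigma>) \<subseteq> U"
    and algorithm: "NR_LALM f c \<beta> \<rho> x lam p"
begin

abbreviation "\<kappa> \<equiv> kappa_lin L_c"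
abbreviation "A \<equiv> A_p \<beta> \<rho> \<Delta> M L_c"
abbreviation "B \<equiv> B_p \<beta> \<rho> \<Delta> \<Lambda> L_f M L_c"
abbreviation "C \<equiv> C_lam_p \<beta> \<rho> \<Delta> \<Lambda> L_f M L_c \<sigma>"
abbreviation "\<Phi> \<equiv> Phi_1 f (x 0) \<beta> \<rho> \<Delta> \<Lambda> G L_f M L_c \<sigma>"
abbreviation "S \<equiv> S_det f c (x 0) \<beta> \<rho> \<Delta> \<Lambda> G L_f M L_c \<sigma>"
abbreviation "Lag \<equiv> aug_Lagrangian f c \<rho>"
abbreviation "g k \<equiv> grad f (x k)"
abbreviation "J k \<equiv> grad_mat c (x k)"
abbreviation "r k \<equiv> c (x (Suc k)) - c (x k) - transpose (J k) *v p k"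

text \<open>The invariant of the induction: membership in \<open>S\<close> leaves room \<Delta>
  around \<open>x k\<close> inside \<open>U\<close>, and the two bounds on constraint and multiplier
  limit the step to that room.\<close>

definition good :: "nat \<Rightarrow> bool"
  where "good k \<longleftrightarrow> x k \<in> S \<and> norm (lam k) \<le> \<Lambda>"

lemma pos: "G > 0" "L_f > 0" "M > 0" "L_c > 0" "\<sigma> > 0" "\<beta> > 0" "\<rho> > 0" "\<Delta> > 0" "\<Lambda> > 0"
  and kappa_pos: "\<kappa> > 0"
  using regularity parameters by (simp_all add: regularity_assumption_def parameter_assumption_def kappa_lin_def)

lemma A_pos: "A > 0" and C_pos: "C > 0"
proof -
  show A: "A > 0"
    using pos kappa_pos by (simp add: A_p_def add_pos_pos)
  have "0 < max (A\<^sup>2) (B\<^sup>2)"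
    using A by (simp add: less_max_iff_disj)
  then show "C > 0"
    using pos by (simp add: C_lam_p_def)
qed

lemma C_over_rho: "C / \<rho> \<le> \<beta> / 8"
  using parameters pos by (simp add: parameter_assumption_def field_simps)

lemma regularity_at:
  assumes "y \<in> U"
  shows f_diff: "f differentiable (at y)" and c_diff: "c differentiable (at y)"
    and grad_le: "norm (grad f y) \<le> G" and jac_le: "spectral_norm (grad_mat c y) \<le> M"
    and jac_ge: "\<sigma> * norm u \<le> norm (grad_mat c y *v u)"
  using assms regularity C1_on_differentiable unfolding regularity_assumption_def by blast+

lemma lipschitz:
  assumes "y \<in> U" "z \<in> U"
  shows grad_lip: "norm (grad f y - grad f z) \<le> L_f * norm (y - z)"
    and jac_lip: "spectral_norm (grad_mat c y - grad_mat c z) \<le> L_c * norm (y - z)"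
  using assms regularity unfolding regularity_assumption_def by blast+

lemma x_Suc: "x (Suc k) = x k + p k"
  and lam_Suc: "lam (Suc k) = lam k + \<rho> *\<^sub>R c (x (Suc k))"
  and step_eq: "\<beta> *\<^sub>R p k + \<rho> *\<^sub>R (J k *v (transpose (J k) *v p k)) = - g k - J k *v (lam k + \<rho> *\<^sub>R c (x k))"
  using algorithm unfolding NR_LALM_def
  by (auto simp: matrix_vector_mult_add_rdistrib matrix_vector_mul_assoc simp flip: scaleR_matrix_vector_assoc)

lemma S_shift_in_U:
  assumes "y \<in> S" "norm h \<le> \<Delta>"
  shows "y + h \<in> U"
proof -
  have "infdist (y + h) S \<le> dist (y + h) y"
    by (rule infdist_le[OF assms(1)])
  then have "y + h \<in> nbhd \<Delta> S"
    using assms by (auto simp: nbhd_def dist_norm)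
  then show ?thesis
    using localization by blast
qed

lemma S_subset_U: "y \<in> S \<Longrightarrow> y \<in> U"
  using S_shift_in_U[of y 0] pos by simp

lemma S_constraint_le: "y \<in> S \<Longrightarrow> norm (c y) \<le> 2 * \<Lambda> / \<rho>"
  by (simp add: S_det_def)

section \<open>One-step estimates from a localized iterate\<close>

context
  fixes k assumes good: "good k"
begin

lemma x_in_S: "x k \<in> S" and x_in_U: "x k \<in> U" and lam_le: "norm (lam k) \<le> \<Lambda>"
  using good S_subset_U by (auto simp: good_def)

text \<open>The source of the second parameter condition: the shifted multiplier is at most
  \<Lambda> + \<rho> (2 \<Lambda> / \<rho>) = 3 \<Lambda>.\<close>

lemma p_le: "norm (p k) \<le> \<Delta>"
proof -
  let ?v = "lam k + \<rho> *\<^sub>R c (x k)"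
  have "norm ?v \<le> norm (lam k) + \<rho> * norm (c (x k))"
    using norm_triangle_ineq[of "lam k" "\<rho> *\<^sub>R c (x k)"] pos by simp
  also have "\<dots> \<le> \<Lambda> + \<rho> * (2 * \<Lambda> / \<rho>)"
    using lam_le S_constraint_le[OF x_in_S] pos by (intro add_mono mult_left_mono) auto
  finally have v: "norm ?v \<le> 3 * \<Lambda>"
    using pos by simp
  have den: "\<beta> + \<rho> * \<sigma>\<^sup>2 > 0"
    using pos by (simp add: add_pos_pos)
  have "norm (p k) \<le> norm (g k) / \<beta> + M * norm ?v / (\<beta> + \<rho> * \<sigma>\<^sup>2)"
    using pos by (intro tikhonov_step_bound[OF _ _ jac_le[OF x_in_U] jac_ge[OF x_in_U] _ step_eq])
  also have "\<dots> \<le> G / \<beta> + M * (3 * \<Lambda>) / (\<beta> + \<rho> * \<sigma>\<^sup>2)"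
    using pos grad_le[OF x_in_U] v den
    by (intro add_mono divide_right_mono mult_left_mono) auto
  also have "\<dots> \<le> \<Delta>"
    using parameters by (simp add: parameter_assumption_def mult_ac)
  finally show ?thesis .
qed

lemma segment_in_U: "x k + t *\<^sub>R p k \<in> U" if "t \<in> {0..1}" for t
proof (rule S_shift_in_U[OF x_in_S])
  have "norm (t *\<^sub>R p k) \<le> 1 * norm (p k)"
    using that by (simp only: norm_scaleR) (intro mult_right_mono, auto)
  then show "norm (t *\<^sub>R p k) \<le> \<Delta>"
    using p_le by simp
qed

lemma constraint_error: "norm (r k) \<le> \<kappa> * (norm (p k))\<^sup>2"
proof -
  let ?D = "\<lambda>y h. transpose (grad_mat c y) *v h"
  have "norm (c (x k + p k) - c (x k) - ?D (x k) (p k)) \<le> L_c / 2 * (norm (p k))\<^sup>2"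
  proof (rule linearization_error)
    fix t :: real assume t: "t \<in> {0..1}"
    note y = segment_in_U[OF t]
    show "(c has_derivative ?D (x k + t *\<^sub>R p k)) (at (x k + t *\<^sub>R p k))"
      by (rule has_derivative_grad_mat[OF c_diff[OF y]])
    have "?D (x k + t *\<^sub>R p k) (p k) - ?D (x k) (p k)
        = transpose (grad_mat c (x k + t *\<^sub>R p k) - J k) *v p k"
      by (simp add: transpose_diff_vector)
    also have "norm \<dots> \<le> (L_c * norm (t *\<^sub>R p k)) * norm (p k)"
      using jac_lip[OF y x_in_U] by (intro norm_transpose_vector_le) simp
    finally show "norm (?D (x k + t *\<^sub>R p k) (p k) - ?D (x k) (p k)) \<le> L_c * t * (norm (p k))\<^sup>2"
      using t by (simp add: power2_eq_square mult_ac)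
  qed
  then show ?thesis
    by (simp add: x_Suc kappa_lin_def)
qed

lemma objective_error: "f (x (Suc k)) - f (x k) - p k \<bullet> g k \<le> L_f / 2 * (norm (p k))\<^sup>2"
proof -
  let ?D = "\<lambda>y h. h \<bullet> grad f y"
  have "norm (f (x k + p k) - f (x k) - ?D (x k) (p k)) \<le> L_f / 2 * (norm (p k))\<^sup>2"
  proof (rule linearization_error)
    fix t :: real assume t: "t \<in> {0..1}"
    note y = segment_in_U[OF t]
    show "(f has_derivative ?D (x k + t *\<^sub>R p k)) (at (x k + t *\<^sub>R p k))"
      using GDERIV_grad[OF f_diff[OF y]] by (simp add: gderiv_def)
    have "norm (?D (x k + t *\<^sub>R p k) (p k) - ?D (x k) (p k))
        = norm (p k \<bullet> (grad f (x k + t *\<^sub>R p k) - g k))"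
      by (simp add: inner_diff_right)
    also have "\<dots> \<le> norm (p k) * norm (grad f (x k + t *\<^sub>R p k) - g k)"
      using Cauchy_Schwarz_ineq2 by simp
    also have "\<dots> \<le> norm (p k) * (L_f * norm (t *\<^sub>R p k))"
      using grad_lip[OF y x_in_U] by (intro mult_left_mono) auto
    finally show "norm (?D (x k + t *\<^sub>R p k) (p k) - ?D (x k) (p k)) \<le> L_f * t * (norm (p k))\<^sup>2"
      using t by (simp add: power2_eq_square mult_ac)
  qed
  then show ?thesis
    unfolding x_Suc real_norm_def by linarith
qed

text \<open>The Newton system contains the linearized constraint, the multiplier update its true
  value at the new point. Their difference is the remainder \<open>r k\<close>, the only error
  besides the proximal term.\<close>

lemma stationarity: "g k + J k *v lam (Suc k) = \<rho> *\<^sub>R (J k *v r k) - \<beta> *\<^sub>R p k"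
proof -
  have "lam (Suc k) = lam k + \<rho> *\<^sub>R c (x k) + \<rho> *\<^sub>R (transpose (J k) *v p k) + \<rho> *\<^sub>R r k"
    by (simp add: lam_Suc algebra_simps)
  then have "J k *v lam (Suc k) = J k *v (lam k + \<rho> *\<^sub>R c (x k))
      + \<rho> *\<^sub>R (J k *v (transpose (J k) *v p k)) + \<rho> *\<^sub>R (J k *v r k)"
    by (simp only: matrix_vector_right_distrib matrix_vector_mult_scaleR)
  then show ?thesis
    using step_eq[of k] by (simp add: algebra_simps)
qed

lemma stationarity_le: "norm (g k + J k *v lam (Suc k)) \<le> A * norm (p k)"
proof -
  have "norm (g k + J k *v lam (Suc k)) \<le> \<rho> * norm (J k *v r k) + \<beta> * norm (p k)"
    unfolding stationarity using norm_triangle_ineq4[of "\<rho> *\<^sub>R (J k *v r k)" "\<beta> *\<^sub>R p k"] pos by simp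
  also have "norm (J k *v r k) \<le> M * norm (r k)"
    by (rule norm_matrix_vector_le[OF jac_le[OF x_in_U]])
  also have "norm (r k) \<le> \<kappa> * (norm (p k))\<^sup>2"
    by (rule constraint_error)
  \<comment> \<open>One factor |p| is traded for \<Delta>, which turns the quadratic remainder into
    a contribution to the linear coefficient \<open>A\<close>.\<close>
  also have "(norm (p k))\<^sup>2 \<le> \<Delta> * norm (p k)"
    using p_le by (simp add: power2_eq_square mult_right_mono)
  finally show ?thesis
    using pos kappa_pos by (simp add: A_p_def algebra_simps)
qed

text \<open>Stationarity and the lower bound \<sigma> recover the multiplier from the gradient,
  independently of the size of the old one apart from |p|. The matrix is taken at
  \<open>x k\<close>, since the new point is not yet known to lie in \<open>S\<close>. The first
  parameter condition closes the estimate.\<close>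

lemma lam_Suc_le: "norm (lam (Suc k)) \<le> \<Lambda>"
proof -
  have "\<sigma> * norm (lam (Suc k)) \<le> norm (J k *v lam (Suc k))"
    by (rule jac_ge[OF x_in_U])
  also have "\<dots> \<le> norm (g k + J k *v lam (Suc k)) + norm (g k)"
    using norm_triangle_ineq4[of "g k + J k *v lam (Suc k)" "g k"] by simp
  also have "\<dots> \<le> A * \<Delta> + G"
    using stationarity_le mult_left_mono[OF p_le, of A] A_pos grad_le[OF x_in_U] by linarith
  also have "\<dots> = G + \<beta> * \<Delta> + \<rho> * M * \<kappa> * \<Delta>\<^sup>2"
    by (simp add: A_p_def power2_eq_square algebra_simps)
  also have "\<dots> \<le> \<sigma> * \<Lambda>"
    using parameters pos by (simp add: parameter_assumption_def field_simps)
  finally show ?thesis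
    using pos by simp
qed

text \<open>The new constraint value is the dual increment divided by \<rho>, and both multipliers
  have norm at most \<Lambda>; hence the threshold in \<open>S_det\<close>.\<close>

lemma c_Suc_le: "norm (c (x (Suc k))) \<le> 2 * \<Lambda> / \<rho>"
proof -
  have "\<rho> * norm (c (x (Suc k))) = norm (lam (Suc k) - lam k)"
    using pos by (simp add: lam_Suc)
  also have "\<dots> \<le> 2 * \<Lambda>"
    using norm_triangle_ineq4[of "lam (Suc k)" "lam k"] lam_le lam_Suc_le by simp
  finally show ?thesis
    using pos by (simp add: field_simps)
qed

text \<open>The tested equation supplies - \<beta> |p|^2 - \<rho> |q|^2, and half of the second term
  cancels the contribution of q to the penalty. All remainders cost at most \<open>C_mod\<close>
  |p|^2, and \<open>C_mod\<close> \<le> 3 \<beta> / 8 leaves 5 \<beta> / 8.\<close>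

lemma primal_descent: "Lag (x (Suc k)) (lam k) \<le> Lag (x k) (lam k) - 5 * \<beta> / 8 * (norm (p k))\<^sup>2"
proof -
  define q s e where "q = transpose (J k) *v p k" and "s = (norm (p k))\<^sup>2" and "e = r k"
  have s0: "0 \<le> s" by (simp add: s_def)
  have cS: "c (x (Suc k)) = c (x k) + q + e"
    by (simp add: q_def e_def)
  \<comment> \<open>the Newton equation tested with the step itself\<close>
  have "\<beta> * s + \<rho> * (norm q)\<^sup>2 = (\<beta> *\<^sub>R p k + \<rho> *\<^sub>R (J k *v q)) \<bullet> p k"
    by (simp add: q_def s_def inner_add_left inner_matrix_vector power2_norm_eq_inner)
  also have "\<dots> = - (p k \<bullet> g k) - (lam k + \<rho> *\<^sub>R c (x k)) \<bullet> q"
    unfolding q_def step_eq by (simp only: inner_diff_left inner_minus_left inner_matrix_vector inner_commute[of "g k" "p k"])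
  finally have model: "p k \<bullet> g k + lam k \<bullet> q + \<rho> * (c (x k) \<bullet> q) = - \<beta> * s - \<rho> * (norm q)\<^sup>2"
    by (simp add: inner_add_left)
  have rk: "norm e \<le> \<kappa> * s"
    using constraint_error by (simp add: s_def e_def)
  have "norm q \<le> M * norm (p k)"
    unfolding q_def by (rule norm_transpose_vector_le[OF jac_le[OF x_in_U]])
  also have "\<dots> \<le> M * \<Delta>"
    using p_le pos by simp
  finally have nq: "norm q \<le> M * \<Delta>" .
  have "lam k \<bullet> e \<le> norm (lam k) * norm e"
    by (rule norm_cauchy_schwarz)
  also have "\<dots> \<le> \<Lambda> * (\<kappa> * s)"
    using lam_le rk pos by (intro mult_mono) auto
  finally have e1: "lam k \<bullet> e \<le> \<Lambda> * (\<kappa> * s)" .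
  have "(c (x k) + q) \<bullet> e \<le> norm (c (x k) + q) * norm e"
    by (rule norm_cauchy_schwarz)
  also have "\<dots> \<le> (2 * \<Lambda> / \<rho> + M * \<Delta>) * (\<kappa> * s)"
    using norm_triangle_ineq[of "c (x k)" q] S_constraint_le[OF x_in_S] nq rk pos
    by (intro mult_mono) auto
  finally have "\<rho> * ((c (x k) + q) \<bullet> e) \<le> \<rho> * ((2 * \<Lambda> / \<rho> + M * \<Delta>) * (\<kappa> * s))"
    using pos by simp
  also have "\<dots> = (2 * \<Lambda> + \<rho> * M * \<Delta>) * (\<kappa> * s)"
    using pos by (simp add: field_simps)
  finally have e2: "\<rho> * ((c (x k) + q) \<bullet> e) \<le> (2 * \<Lambda> + \<rho> * M * \<Delta>) * (\<kappa> * s)" .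
  have "(norm e)\<^sup>2 \<le> (\<kappa> * s)\<^sup>2"
    using rk by (intro power_mono) auto
  also have "\<dots> = \<kappa>\<^sup>2 * s * s"
    by (simp add: power2_eq_square)
  also have "\<dots> \<le> \<kappa>\<^sup>2 * \<Delta>\<^sup>2 * s"
    using s0 p_le pos by (intro mult_right_mono mult_left_mono) (auto simp: s_def intro!: power_mono)
  finally have e3: "\<rho> / 2 * (norm e)\<^sup>2 \<le> \<rho> / 2 * (\<kappa>\<^sup>2 * \<Delta>\<^sup>2 * s)"
    using pos by simp
  have sq: "(norm (c (x k) + q + e))\<^sup>2 = (norm (c (x k)))\<^sup>2 + 2 * (c (x k) \<bullet> q) + (norm q)\<^sup>2
      + 2 * ((c (x k) + q) \<bullet> e) + (norm e)\<^sup>2"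
    unfolding power2_norm_eq_inner by (simp add: inner_add_left inner_add_right inner_commute)
  have "Lag (x (Suc k)) (lam k) - Lag (x k) (lam k)
      = (f (x (Suc k)) - f (x k) - p k \<bullet> g k) + (p k \<bullet> g k + lam k \<bullet> q + \<rho> * (c (x k) \<bullet> q))
        + lam k \<bullet> e + \<rho> / 2 * (norm q)\<^sup>2 + \<rho> * ((c (x k) + q) \<bullet> e) + \<rho> / 2 * (norm e)\<^sup>2"
    unfolding aug_Lagrangian_def cS sq by (simp add: inner_add_right field_simps)
  also have "\<dots> \<le> L_f / 2 * s + (- \<beta> * s - \<rho> * (norm q)\<^sup>2) + \<Lambda> * (\<kappa> * s) + \<rho> / 2 * (norm q)\<^sup>2
        + (2 * \<Lambda> + \<rho> * M * \<Delta>) * (\<kappa> * s) + \<rho> / 2 * (\<kappa>\<^sup>2 * \<Delta>\<^sup>2 * s)"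
    using objective_error model e1 e2 e3 by (simp add: s_def)
  \<comment> \<open>\<open>C_mod\<close> gathers L_f / 2 from \<open>f\<close>, \<kappa> (\<Lambda>
    + 2 \<Lambda> + \<rho> M \<Delta>) from the terms linear in \<open>e\<close>, and \<rho> / 2
    \<kappa>^2 \<Delta>^2 from its square.\<close>
  also have "\<dots> = (C_mod \<rho> \<Delta> \<Lambda> L_f M L_c - \<beta>) * s - \<rho> / 2 * (norm q)\<^sup>2"
    by (simp add: C_mod_def field_simps)
  also have "\<dots> \<le> (C_mod \<rho> \<Delta> \<Lambda> L_f M L_c - \<beta>) * s"
    using pos by simp
  also have "\<dots> \<le> (- 5 * \<beta> / 8) * s"
    using parameters s0 by (intro mult_right_mono) (auto simp: parameter_assumption_def)
  finally show ?thesis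
    by (simp add: s_def)
qed

end

section \<open>Dual increments and invariance of the localization\<close>

lemma dual_step_le:
  assumes "good k" "good (Suc k)"
  shows "(norm (lam (Suc (Suc k)) - lam (Suc k)))\<^sup>2 \<le> C / 2 * ((norm (p (Suc k)))\<^sup>2 + (norm (p k))\<^sup>2)"
proof -
  let ?a = "norm (p (Suc k))" and ?b = "norm (p k)"
  let ?d = "lam (Suc (Suc k)) - lam (Suc k)"
  note U = x_in_U[OF assms(1)] x_in_U[OF assms(2)]
  have xd: "x (Suc k) - x k = p k" by (simp add: x_Suc)
  \<comment> \<open>The changes of gradient and matrix between the two points are charged to the old
    step, so |p k| gets the coefficient A + L_f + L_c \<Lambda>, which is \<open>B\<close>.\<close>
  have split: "J (Suc k) *v ?d = (g (Suc k) + J (Suc k) *v lam (Suc (Suc k))) - (g k + J k *v lam (Suc k))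
      - (g (Suc k) - g k) - (J (Suc k) - J k) *v lam (Suc k)"
    by (simp add: matrix_vector_mult_diff_distrib matrix_vector_mult_diff_rdistrib)
  have "norm (J (Suc k) *v ?d) \<le> norm (g (Suc k) + J (Suc k) *v lam (Suc (Suc k))) + norm (g k + J k *v lam (Suc k))
      + norm (g (Suc k) - g k) + norm ((J (Suc k) - J k) *v lam (Suc k))"
    unfolding split by (rule norm_triangle_diff3)
  also have "\<dots> \<le> A * ?a + A * ?b + L_f * ?b + (L_c * ?b) * \<Lambda>"
  proof -
    have "norm ((J (Suc k) - J k) *v lam (Suc k)) \<le> (L_c * ?b) * norm (lam (Suc k))"
      using jac_lip[OF U(2,1)] by (intro norm_matrix_vector_le) (simp add: xd)
    also have "\<dots> \<le> (L_c * ?b) * \<Lambda>"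
      using lam_le[OF assms(2)] pos by (intro mult_left_mono) auto
    finally show ?thesis
      using stationarity_le[OF assms(1)] stationarity_le[OF assms(2)] grad_lip[OF U(2,1)]
      by (simp add: xd)
  qed
  also have "\<dots> = A * ?a + B * ?b"
    by (simp add: B_p_def algebra_simps)
  finally have "\<sigma> * norm ?d \<le> A * ?a + B * ?b"
    using jac_ge[OF U(2), of ?d] by linarith
  then have "(\<sigma> * norm ?d)\<^sup>2 \<le> (A * ?a + B * ?b)\<^sup>2"
    using pos by (intro power_mono) auto
  also have "\<dots> \<le> 2 * (A\<^sup>2 * ?a\<^sup>2 + B\<^sup>2 * ?b\<^sup>2)"
    using zero_le_power2[of "A * ?a - B * ?b"] by (simp add: power2_eq_square algebra_simps)
  also have "\<dots> \<le> 2 * (max (A\<^sup>2) (B\<^sup>2) * ?a\<^sup>2 + max (A\<^sup>2) (B\<^sup>2) * ?b\<^sup>2)"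
    by (intro mult_left_mono add_mono mult_right_mono) auto
  finally show ?thesis
    using pos by (simp add: C_lam_p_def field_simps power_mult_distrib)
qed

lemma dual_ascent: "Lag (x (Suc k)) (lam (Suc k)) = Lag (x (Suc k)) (lam k) + (norm (lam (Suc k) - lam k))\<^sup>2 / \<rho>"
  using pos by (simp add: aug_Lagrangian_def lam_Suc inner_add_left power_mult_distrib
      dot_square_norm power2_eq_square)

lemma descent:
  assumes "good k" "good (Suc k)"
  shows "Lag (x (Suc (Suc k))) (lam (Suc (Suc k))) \<le> Lag (x (Suc k)) (lam (Suc k))
    - 5 * \<beta> / 8 * (norm (p (Suc k)))\<^sup>2 + C / \<rho> / 2 * ((norm (p (Suc k)))\<^sup>2 + (norm (p k))\<^sup>2)"
  using primal_descent[OF assms(2)] divide_right_mono[OF dual_step_le[OF assms], of \<rho>] pos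
  by (simp add: dual_ascent[of "Suc k"] mult_ac)

lemma good_0: "good 0"
proof -
  have "f (x 0) \<le> H_det f (x 0) \<beta> \<rho> \<Delta> \<Lambda> G L_f M L_c \<sigma>"
    using pos C_pos by (simp add: H_det_def Phi_1_def)
  moreover have "norm (c (x 0)) \<le> 2 * \<Lambda> / \<rho>"
    using parameters pos by (simp add: parameter_assumption_def field_simps)
  ultimately show ?thesis
    using parameters by (simp add: good_def S_det_def parameter_assumption_def)
qed

text \<open>Completing the square bounds \<open>f\<close> by the augmented Lagrangian plus |lam|^2 /
  (2 \<rho>), the origin of the extra term in \<open>H_det\<close>.\<close>

lemma good_SucI:
  assumes "good k" and \<Phi>: "Lag (x (Suc k)) (lam (Suc k)) \<le> \<Phi>"
  shows "good (Suc k)"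
proof -
  let ?l = "lam (Suc k)" and ?c = "c (x (Suc k))"
  have l: "norm ?l \<le> \<Lambda>"
    by (rule lam_Suc_le[OF assms(1)])
  have "0 \<le> (norm (?l + \<rho> *\<^sub>R ?c))\<^sup>2 / (2 * \<rho>)"
    using pos by simp
  also have "\<dots> = (norm ?l)\<^sup>2 / (2 * \<rho>) + ?l \<bullet> ?c + \<rho> / 2 * (norm ?c)\<^sup>2"
    using pos unfolding power2_norm_eq_inner
    by (simp add: inner_add_left inner_add_right inner_commute field_simps)
  finally have "f (x (Suc k)) \<le> Lag (x (Suc k)) ?l + (norm ?l)\<^sup>2 / (2 * \<rho>)"
    by (simp add: aug_Lagrangian_def)
  also have "\<dots> \<le> \<Phi> + \<Lambda>\<^sup>2 / (2 * \<rho>)"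
    using \<Phi> l pos by (intro add_mono divide_right_mono power_mono) auto
  finally show ?thesis
    using l c_Suc_le[OF assms(1)] by (simp add: good_def S_det_def H_det_def)
qed

text \<open>No earlier stationarity equation exists to control the first dual increment, so each
  term is bounded separately. The term 4 \<Lambda>^2 / \<rho> in \<open>Phi_1\<close> is 2
  \<Lambda>^2 / \<rho> from the multiplier term plus 2 \<Lambda>^2 / \<rho> from the
  penalty.\<close>

lemma first_step: "Lag (x 1) (lam 1) + C / \<rho> * (norm (p 0))\<^sup>2 \<le> \<Phi>"
proof -
  let ?c = "c (x 1)"
  have "norm (f (x 0 + p 0) - f (x 0)) \<le> G * norm ((x 0 + p 0) - x 0)"
  proof (rule differentiable_bound[of "closed_segment (x 0) (x 0 + p 0)"])
    fix y assume "y \<in> closed_segment (x 0) (x 0 + p 0)"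
    then obtain t where t: "t \<in> {0..1}" and y: "y = x 0 + t *\<^sub>R p 0"
      by (auto simp: in_segment algebra_simps)
    have yU: "y \<in> U"
      using segment_in_U[OF good_0 t] y by simp
    show "(f has_derivative (\<lambda>h. h \<bullet> grad f y)) (at y within closed_segment (x 0) (x 0 + p 0))"
      using GDERIV_grad[OF f_diff[OF yU]] by (simp add: gderiv_def has_derivative_at_withinI)
    show "onorm (\<lambda>h. h \<bullet> grad f y) \<le> G"
      using grad_le[OF yU] onorm_inner_left[OF bounded_linear_ident, of "grad f y"] by (simp add: onorm_id)
  qed auto
  also have "\<dots> \<le> G * \<Delta>"
    using p_le[OF good_0] pos by simp
  finally have "f (x 1) \<le> f (x 0) + G * \<Delta>"
    by (simp add: x_Suc)
  moreover have "lam 1 \<bullet> ?c \<le> \<Lambda> * (2 * \<Lambda> / \<rho>)"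
    using pos lam_Suc_le[OF good_0] c_Suc_le[OF good_0]
    by (intro order_trans[OF norm_cauchy_schwarz mult_mono]) auto
  moreover have "(norm ?c)\<^sup>2 \<le> (2 * \<Lambda> / \<rho>)\<^sup>2"
    using c_Suc_le[OF good_0] by (intro power_mono) auto
  then have "\<rho> / 2 * (norm ?c)\<^sup>2 \<le> \<rho> / 2 * (2 * \<Lambda> / \<rho>)\<^sup>2"
    using pos by simp
  then have "\<rho> / 2 * (norm ?c)\<^sup>2 \<le> 2 * \<Lambda>\<^sup>2 / \<rho>"
    using pos by (simp add: power2_eq_square field_simps)
  moreover have "C / \<rho> * (norm (p 0))\<^sup>2 \<le> C / \<rho> * \<Delta>\<^sup>2"
    using p_le[OF good_0] C_pos pos by (intro mult_left_mono power_mono) auto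
  ultimately show ?thesis
    by (simp add: aug_Lagrangian_def Phi_1_def power2_eq_square)
qed

text \<open>Two consecutive good indices are carried along because \<open>descent\<close> asks for
  both. The old square is covered by the potential, and the new one costs 3 C / (2 \<rho>) \<le> 3
  \<beta> / 16, below the available 5 \<beta> / 8.\<close>

lemma lyapunov: "good k \<and> good (Suc k) \<and> Lag (x (Suc k)) (lam (Suc k)) + C / \<rho> * (norm (p k))\<^sup>2 \<le> \<Phi>"
proof (induction k)
  case 0
  have "0 \<le> C / \<rho> * (norm (p 0))\<^sup>2"
    using C_pos pos by simp
  then show ?case
    using first_step good_0 good_SucI[OF good_0] by simp
next
  case (Suc k)
  let ?a = "(norm (p (Suc k)))\<^sup>2" and ?b = "(norm (p k))\<^sup>2"
  have IH: "good k" "good (Suc k)" "Lag (x (Suc k)) (lam (Suc k)) + C / \<rho> * ?b \<le> \<Phi>"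
    using Suc.IH by auto
  have "C / \<rho> * ?a \<le> \<beta> / 8 * ?a"
    by (rule mult_right_mono[OF C_over_rho]) simp
  moreover have "0 \<le> C / \<rho> * ?b" "0 \<le> \<beta> * ?a" "0 \<le> C / \<rho> * ?a"
    using C_pos pos by simp_all
  moreover have "C / \<rho> / 2 * (?a + ?b) = C / \<rho> * ?a / 2 + C / \<rho> * ?b / 2"
    by (simp add: add_divide_distrib distrib_left)
  ultimately have "Lag (x (Suc (Suc k))) (lam (Suc (Suc k))) + C / \<rho> * ?a \<le> \<Phi>"
    using IH(3) descent[OF IH(1,2)] by argo
  then show ?case
    using Suc good_SucI[of "Suc k"] \<open>0 \<le> C / \<rho> * ?a\<close> by auto
qed

lemma all_good: "good k"
  using lyapunov by blast

section \<open>Merit function, finite length and limit\<close>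

lemma merit_descent:
  "3 * \<beta> / 16 * (norm (p (Suc k)))\<^sup>2 \<le> merit f c \<beta> \<rho> (x (Suc k), lam (Suc k), p k)
    - merit f c \<beta> \<rho> (x (Suc (Suc k)), lam (Suc (Suc k)), p (Suc k))"
proof -
  let ?a = "(norm (p (Suc k)))\<^sup>2" and ?b = "(norm (p k))\<^sup>2"
  \<comment> \<open>The dual error costs \<beta> / 16 on each square, while the last merit term
    gains \<beta> / 4 on \<open>?b\<close> and loses it on \<open>?a\<close>. This leaves 5 \<beta>
    / 16 of \<open>?a\<close> and 3 \<beta> / 16 of \<open>?b\<close>; the claim keeps 3 \<beta> /
    16 of \<open>?a\<close>.\<close>
  have "C / \<rho> / 2 * (?a + ?b) \<le> \<beta> / 8 / 2 * (?a + ?b)"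
    using C_over_rho by (intro mult_right_mono divide_right_mono) auto
  moreover have "0 \<le> \<beta> * ?a" "0 \<le> \<beta> * ?b"
    using pos by simp_all
  ultimately show ?thesis
    using descent[OF all_good all_good, of k] unfolding merit_def prod.case by argo
qed

lemma dual_norm_le: "norm (lam (Suc (Suc k)) - lam (Suc k)) \<le> sqrt C * (norm (p (Suc k)) + norm (p k))"
proof (rule power2_le_imp_le)
  let ?a = "norm (p (Suc k))" and ?b = "norm (p k)"
  have "C / 2 * (?a\<^sup>2 + ?b\<^sup>2) \<le> C * (?a + ?b)\<^sup>2"
    using C_pos by (simp add: power2_sum)
  then have "(norm (lam (Suc (Suc k)) - lam (Suc k)))\<^sup>2 \<le> C * (?a + ?b)\<^sup>2"
    by (rule order_trans[OF dual_step_le[OF all_good all_good]])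
  then show "(norm (lam (Suc (Suc k)) - lam (Suc k)))\<^sup>2 \<le> (sqrt C * (?a + ?b))\<^sup>2"
    using C_pos by (simp add: power_mult_distrib)
qed (use C_pos in simp)

lemma GDERIV_merit:
  assumes "y \<in> U"
  shows "GDERIV (merit f c \<beta> \<rho>) (y, l, w) :>
    (grad f y + grad_mat c y *v (l + \<rho> *\<^sub>R c y), c y, (\<beta> / 2) *\<^sub>R w)"
proof -
  let ?z = "(y, l, w)"
  have f': "((\<lambda>z. f (fst z)) has_derivative (\<lambda>h. fst h \<bullet> grad f y)) (at ?z)"
    by (rule has_derivative_compose[OF has_derivative_fst[OF has_derivative_ident]])
       (use GDERIV_grad[OF f_diff[OF assms]] in \<open>simp add: gderiv_def\<close>)
  have c': "((\<lambda>z. c (fst z)) has_derivative (\<lambda>h. transpose (grad_mat c y) *v fst h)) (at ?z)"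
    by (rule has_derivative_compose[OF has_derivative_fst[OF has_derivative_ident]])
       (use has_derivative_grad_mat[OF c_diff[OF assms]] in simp)
  have transpose_inner: "v \<bullet> (transpose (grad_mat c y) *v h) = h \<bullet> (grad_mat c y *v v)" for v h
    by (metis inner_matrix_vector inner_commute)
  \<comment> \<open>Squared norms become inner products, which the derivative rules treat without an
    exception at 0.\<close>
  have merit_eq: "merit f c \<beta> \<rho> = (\<lambda>z. f (fst z) + fst (snd z) \<bullet> c (fst z)
      + \<rho> / 2 * (c (fst z) \<bullet> c (fst z)) + \<beta> / 4 * (snd (snd z) \<bullet> snd (snd z)))"
    by (simp add: merit_def aug_Lagrangian_def fun_eq_iff power2_norm_eq_inner)
  show ?thesis
    unfolding gderiv_def merit_eq
    by (rule derivative_eq_intros f' c' refl)+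
       (simp add: fun_eq_iff inner_add_left inner_add_right matrix_vector_right_distrib
          matrix_vector_mult_scaleR transpose_inner inner_commute[of _ "c y"] inner_commute[of _ w] algebra_simps)
qed

text \<open>Each block has its own source: the primal one is the Newton system and costs the newest
  step; the dual one is the constraint value, a dual increment over \<rho>, and costs the two older
  steps; the last one is a multiple of the middle step.\<close>

lemma merit_gradient_le:
  "norm (grad (merit f c \<beta> \<rho>) (x (Suc (Suc k)), lam (Suc (Suc k)), p (Suc k)))
    \<le> (\<beta> + \<rho> * M\<^sup>2 + sqrt C / \<rho>) * (norm (p (Suc (Suc k))) + norm (p (Suc k)) + norm (p k))"
proof -
  let ?j = "Suc (Suc k)"
  let ?a = "norm (p ?j)" and ?b = "norm (p (Suc k))" and ?d = "norm (p k)"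
  have U: "x ?j \<in> U"
    by (rule x_in_U[OF all_good])
  let ?gx = "g ?j + J ?j *v (lam ?j + \<rho> *\<^sub>R c (x ?j))"
  have "?gx = - (\<beta> *\<^sub>R p ?j + \<rho> *\<^sub>R (J ?j *v (transpose (J ?j) *v p ?j)))"
    unfolding step_eq by simp
  then have "norm ?gx \<le> \<beta> * ?a + \<rho> * norm (J ?j *v (transpose (J ?j) *v p ?j))"
    using norm_triangle_ineq[of "\<beta> *\<^sub>R p ?j" "\<rho> *\<^sub>R (J ?j *v (transpose (J ?j) *v p ?j))"] pos
    by (simp only: norm_minus_cancel) simp
  also have "\<dots> \<le> \<beta> * ?a + \<rho> * (M * (M * ?a))"
    using pos norm_transpose_vector_le[OF jac_le[OF U], of "p ?j"]
    by (intro add_left_mono mult_left_mono order_trans[OF norm_matrix_vector_le[OF jac_le[OF U]]]) auto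
  finally have gx: "norm ?gx \<le> (\<beta> + \<rho> * M\<^sup>2) * ?a"
    by (simp add: power2_eq_square algebra_simps)
  have "\<rho> * norm (c (x ?j)) = norm (lam ?j - lam (Suc k))"
    using pos by (simp add: lam_Suc[of "Suc k"])
  then have gl: "norm (c (x ?j)) \<le> sqrt C / \<rho> * (?b + ?d)"
    using dual_norm_le[of k] pos by (simp add: field_simps)
  have gw: "norm ((\<beta> / 2) *\<^sub>R p (Suc k)) \<le> \<beta> * ?b"
    using pos by simp
  have "norm (grad (merit f c \<beta> \<rho>) (x ?j, lam ?j, p (Suc k)))
      \<le> norm ?gx + (norm (c (x ?j)) + norm ((\<beta> / 2) *\<^sub>R p (Suc k)))"
    unfolding grad_eqI[OF GDERIV_merit[OF U]]
    by (intro order_trans[OF norm_Pair_le] add_left_mono norm_Pair_le)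
  also have "\<dots> \<le> (\<beta> + \<rho> * M\<^sup>2) * ?a + (sqrt C / \<rho> * (?b + ?d) + \<beta> * ?b)"
    by (intro add_mono gx gl gw)
  also have "\<dots> \<le> (\<beta> + \<rho> * M\<^sup>2) * (?a + ?b + ?d) + sqrt C / \<rho> * (?a + ?b + ?d)"
  proof -
    have "0 \<le> \<rho> * M\<^sup>2 * ?b" "0 \<le> (\<beta> + \<rho> * M\<^sup>2) * ?d" "0 \<le> sqrt C / \<rho> * ?a"
      using pos C_pos by simp_all
    then show ?thesis
      unfolding distrib_left distrib_right by linarith
  qed
  finally show ?thesis
    by (simp only: distrib_right)
qed

lemma summable_steps:
  assumes compactness: "compact S"
    and KL: "\<forall>ub \<in> cluster_set (lifted_iterate x lam p).
      KL_property (U \<times> UNIV \<times> UNIV) (merit f c \<beta> \<rho>) ub"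
  shows "summable (\<lambda>k. norm (p k))"
proof (rule KL_finite_length[where u = "lifted_iterate x lam p" and h = "merit f c \<beta> \<rho>" and \<alpha> = "3 * \<beta> / 16"
      and b = "\<beta> + \<rho> * M\<^sup>2 + sqrt C / \<rho>" and K = "S \<times> cball 0 \<Lambda> \<times> cball 0 \<Delta>"])
  let ?K = "S \<times> cball (0 :: real^'m) \<Lambda> \<times> cball (0 :: real^'n) \<Delta>" and ?u = "lifted_iterate x lam p"
  show K: "compact ?K"
    by (intro compact_Times compactness compact_cball)
  show uK: "?u k \<in> ?K" for k
    using all_good p_le[OF all_good] by (simp add: lifted_iterate_def good_def)
  \<comment> \<open>Differentiability of \<open>merit\<close> is known over \<open>U\<close>; a
    cluster point gets there because \<open>?K\<close> is closed and \<open>S\<close> lies in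
    \<open>U\<close>.\<close>
  show "isCont (merit f c \<beta> \<rho>) z" if z: "z \<in> cluster_set ?u" for z
  proof -
    obtain q where "(\<lambda>j. ?u (q j)) \<longlonglongrightarrow> z"
      using z unfolding cluster_set_def by auto
    then have "z \<in> ?K"
      by (rule closed_sequentially[OF compact_imp_closed[OF K] uK])
    then have "fst z \<in> S"
      by (simp add: mem_Times_iff)
    then have "fst z \<in> U"
      by (rule S_subset_U)
    from GDERIV_merit[OF this, of "fst (snd z)" "snd (snd z)"] show ?thesis
      using has_derivative_continuous unfolding gderiv_def prod.collapse by metis
  qed
  show "3 * \<beta> / 16 * (norm (p k))\<^sup>2 \<le> merit f c \<beta> \<rho> (?u k) - merit f c \<beta> \<rho> (?u (Suc k))" if "1 \<le> k" for k
  proof -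
    obtain j where "k = Suc j"
      using \<open>1 \<le> k\<close> by (metis One_nat_def Suc_le_D)
    then show ?thesis
      using merit_descent[of j] by (simp add: lifted_iterate_def)
  qed
  show "norm (grad (merit f c \<beta> \<rho>) (?u (k + 2)))
      \<le> (\<beta> + \<rho> * M\<^sup>2 + sqrt C / \<rho>) * (norm (p (k + 2)) + norm (p (k + 1)) + norm (p k))" for k
    using merit_gradient_le[of k] by (simp add: lifted_iterate_def)
  show "0 < \<beta> + \<rho> * M\<^sup>2 + sqrt C / \<rho>"
    using pos C_pos by (simp add: add_pos_pos)
qed (use pos KL in auto)

lemma summable_dual:
  assumes "summable (\<lambda>k. norm (p k))"
  shows "summable (\<lambda>k. norm (lam (Suc k) - lam k))"
proof (rule summable_Suc_iff[THEN iffD1])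
  have "summable (\<lambda>k. norm (p (Suc k)))"
    by (rule summable_Suc_iff[of "\<lambda>k. norm (p k)", THEN iffD2, OF assms])
  then have "summable (\<lambda>k. sqrt C * (norm (p (Suc k)) + norm (p k)))"
    using assms by (intro summable_mult summable_add)
  then show "summable (\<lambda>k. norm (lam (Suc (Suc k)) - lam (Suc k)))"
    by (rule summable_comparison_test'[where N = 0]) (use dual_norm_le in simp)
qed

text \<open>Feasibility holds because the constraint value is a multiplier increment over \<rho>,
  which vanishes in the limit; stationarity holds because its residual at the limit is below every
  term of a null sequence.\<close>

lemma limit_KKT:
  assumes "closed S" and x_lim: "x \<longlonglongrightarrow> xs" and lam_lim: "lam \<longlonglongrightarrow> ls" and p_lim: "p \<longlonglongrightarrow> 0"
  shows "KKT_pair f c xs ls"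
proof -
  have "xs \<in> S"
    by (rule closed_sequentially[OF assms(1) _ x_lim]) (rule x_in_S[OF all_good])
  then have U: "xs \<in> U"
    by (rule S_subset_U)
  have lam_lim': "(\<lambda>k. lam (Suc k)) \<longlonglongrightarrow> ls"
    by (rule LIMSEQ_Suc[OF lam_lim])
  have "(\<lambda>k. (1 / \<rho>) *\<^sub>R (lam (Suc k) - lam k)) \<longlonglongrightarrow> (1 / \<rho>) *\<^sub>R (ls - ls)"
    by (intro tendsto_intros lam_lim lam_lim')
  then have "(\<lambda>k. c (x (Suc k))) \<longlonglongrightarrow> 0"
    using pos by (simp add: lam_Suc)
  moreover have "(\<lambda>k. c (x (Suc k))) \<longlonglongrightarrow> c xs"
    by (rule isCont_tendsto_compose[OF differentiable_imp_continuous_within[OF c_diff[OF U]] LIMSEQ_Suc[OF x_lim]])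
  ultimately have c0: "c xs = 0"
    using LIMSEQ_unique by blast
  let ?v = "grad f xs + grad_mat c xs *v ls"
  \<comment> \<open>The error of replacing the limit by the pair \<open>x k\<close>,
    \<open>lam (Suc k)\<close>, for which \<open>stationarity_le\<close> holds; the Lipschitz bounds
    pay for the change of base point.\<close>
  let ?e = "\<lambda>k. A * norm (p k) + L_f * norm (x k - xs) + (L_c * norm (x k - xs)) * \<Lambda> + M * norm (lam (Suc k) - ls)"
  have "norm ?v \<le> ?e k" for k
  proof -
    have "?v = (g k + J k *v lam (Suc k)) - (g k - grad f xs)
        - (J k - grad_mat c xs) *v lam (Suc k) - grad_mat c xs *v (lam (Suc k) - ls)"
      by (simp add: matrix_vector_mult_diff_distrib matrix_vector_mult_diff_rdistrib)
    then have "norm ?v \<le> norm (g k + J k *v lam (Suc k)) + norm (g k - grad f xs)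
        + norm ((J k - grad_mat c xs) *v lam (Suc k)) + norm (grad_mat c xs *v (lam (Suc k) - ls))"
      using norm_triangle_diff3 by metis
    moreover have "norm ((J k - grad_mat c xs) *v lam (Suc k)) \<le> (L_c * norm (x k - xs)) * \<Lambda>"
      using lam_Suc_le[OF all_good] pos
      by (intro order_trans[OF norm_matrix_vector_le[OF jac_lip[OF x_in_U[OF all_good] U]]] mult_left_mono) auto
    ultimately show ?thesis
      using stationarity_le[OF all_good, of k] grad_lip[OF x_in_U[OF all_good] U, of k]
        norm_matrix_vector_le[OF jac_le[OF U], of "lam (Suc k) - ls"] by linarith
  qed
  moreover have "?e \<longlonglongrightarrow> A * norm (0 :: real^'n) + L_f * norm (xs - xs) + (L_c * norm (xs - xs)) * \<Lambda> + M * norm (ls - ls)"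
    by (intro tendsto_intros p_lim x_lim lam_lim')
  ultimately have "norm ?v \<le> 0"
    using LIMSEQ_le_const[of ?e] by fastforce
  then show ?thesis
    using c0 U f_diff c_diff by (simp add: KKT_pair_def)
qed

end

theorem theorem2p13:
  fixes f :: "real^'n \<Rightarrow> real" and c :: "real^'n \<Rightarrow> real^'m" and U :: "(real^'n) set"
    and f_low G L_f M L_c \<sigma> \<beta> \<rho> \<Delta> \<Lambda> :: real
    and x :: "nat \<Rightarrow> real^'n" and lam :: "nat \<Rightarrow> real^'m" and p :: "nat \<Rightarrow> real^'n"
  assumes regularity: "regularity_assumption f c U f_low G L_f M L_c \<sigma>"
    and parameters: "parameter_assumption c (x 0) (lam 0) \<beta> \<rho> \<Delta> \<Lambda> G L_f M L_c \<sigma>"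
    and localization: "nbhd \<Delta> (S_det f c (x 0) \<beta> \<rho> \<Delta> \<Lambda> G L_f M L_c \<sigma>) \<subseteq> U"
    and algorithm: "NR_LALM f c \<beta> \<rho> x lam p"
    and compactness: "compact (S_det f c (x 0) \<beta> \<rho> \<Delta> \<Lambda> G L_f M L_c \<sigma>)"
    and KL: "\<forall>ub \<in> cluster_set (lifted_iterate x lam p).
      KL_property (U \<times> UNIV \<times> UNIV) (merit f c \<beta> \<rho>) ub"
  shows "summable (\<lambda>k. norm (x (Suc k) - x k) + norm (lam (Suc k) - lam k)) \<and>
    (\<exists>x_star lam_star. KKT_pair f c x_star lam_star \<and>
      (\<lambda>k. (x k, lam k)) \<longlonglongrightarrow> (x_star, lam_star) \<and>
      lifted_iterate x lam p \<longlonglongrightarrow> (x_star, lam_star, 0))"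
proof -
  interpret NR_LALM_run f c U f_low G L_f M L_c \<sigma> \<beta> \<rho> \<Delta> \<Lambda> x lam p
    by unfold_locales fact+
  have p_sum: "summable (\<lambda>k. norm (p k))"
    by (rule summable_steps[OF compactness KL])
  then have x_sum: "summable (\<lambda>k. norm (x (Suc k) - x k))"
    by (simp add: x_Suc)
  have lam_sum: "summable (\<lambda>k. norm (lam (Suc k) - lam k))"
    by (rule summable_dual[OF p_sum])
  obtain xs ls where lim: "x \<longlonglongrightarrow> xs" "lam \<longlonglongrightarrow> ls"
    using convergent_if_finite_length[OF x_sum] convergent_if_finite_length[OF lam_sum] by metis
  have p_lim: "p \<longlonglongrightarrow> 0"
    by (rule tendsto_norm_zero_cancel[OF summable_LIMSEQ_zero[OF p_sum]])
  \<comment> \<open>The shift passes over k = 0, where \<open>k - 1\<close> is again 0.\<close>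
  then have "(\<lambda>k. p (Suc k - 1)) \<longlonglongrightarrow> 0"
    by simp
  then have "(\<lambda>k. p (k - 1)) \<longlonglongrightarrow> 0"
    by (rule LIMSEQ_imp_Suc)
  then have "(\<lambda>k. (x k, lam k, p (k - 1))) \<longlonglongrightarrow> (xs, ls, 0)"
    by (rule tendsto_Pair[OF lim(1) tendsto_Pair[OF lim(2)]])
  then have "lifted_iterate x lam p \<longlonglongrightarrow> (xs, ls, 0)"
    by (simp add: lifted_iterate_def[abs_def])
  then show ?thesis
    using limit_KKT[OF compact_imp_closed[OF compactness] lim p_lim]
      summable_add[OF x_sum lam_sum] tendsto_Pair[OF lim] by blast
qed

end
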